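(* Let $p,q>0$ and let $X\in\mathfrak{sp}(p,q)$ be a nilpotent element. Let $\mathbf{d}=[d_1^{t_{d_1}},\dots,d_s^{t_{d_s}}]\in\mathcal{P}(p+q)$ be the partition corresponding to the orbit of $X$, and let $\mathbb{E}_{\mathbf d}$ be the set of even parts $d_i$. Then $X$ is strongly real (with respect to $\mathrm{Sp}(p,q)$) if and only if $t_\eta$ is even for all $\eta\in\mathbb{E}_{\mathbf d}$.
   Context: For a Lie group $G$ with Lie algebra $\mathfrak{g}$, $X\in\mathfrak{g}$ is strongly real (strongly $\mathrm{Ad}_G$-real) if $-X=\mathrm{Ad}(\tau)X$ for some $\tau\in G$ with $\tau^2=\mathrm{Id}$. Let $\mathbb{H}$ be the real quaternions with usual conjugation $\overline{\,\cdot\,}$, and $\mathrm{I}_{p,q}=\mathrm{diag}(\mathrm{I}_p,-\mathrm{I}_q)$. $\mathrm{Sp}(p,q)=\{g\in\mathrm{SL}_{p+q}(\mathbb{H})\mid\overline{g}^t\mathrm{I}_{p,q}g=\mathrm{I}_{p,q}\}$, $\mathfrak{sp}(p,q)=\{z\in\mathfrak{sl}_{p+q}(\mathbb{H})\mid\overline{z}^t\mathrm{I}_{p,q}+\mathrm{I}_{p,q}z=0\}$, where $\mathrm{SL}_n(\mathbb{H})$ (resp. $\mathfrak{sl}_n(\mathbb{H})$) consists of the $n\times n$ quaternionic matrices of reduced norm $1$ (resp. reduced trace $0$). Matrices act on the left on the right $\mathbb{H}$-vector space $\mathbb{H}^{p+q}$. $\mathcal{P}(m)$ is the set of partitions of $m$,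 written $[d_1^{t_{d_1}},\dots,d_s^{t_{d_s}}]$ with $d_1>\dots>d_s>0$, $t_{d_i}\geq1$ and $\sum_i t_{d_i}d_i=m$. The partition corresponding to $X$ is given by the sizes of its Jordan blocks as an $\mathbb{H}$-linear nilpotent map ($t_d$ is the number of blocks of size $d$). *)

theory Defs
  imports
    Complex_Main
    "HOL-Library.Multiset"
    "Jordan_Normal_Form.Determinant"
    "Jordan_Normal_Form.Jordan_Normal_Form"
begin

section \<open>Real quaternions\<close>

text \<open>\<open>Quat a b c d\<close> stands for \<open>a + b i + c j + d k\<close>.\<close>

datatype quat = Quat (qre: real) (qim1: real) (qim2: real) (qim3: real)

lemma quat_eq_iff:
  "x = y \<longleftrightarrow> qre x = qre y \<and> qim1 x = qim1 y \<and> qim2 x = qim2 y \<and> qim3 x = qim3 y"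
  by (cases x; cases y) auto

instantiation quat :: division_ring
begin

definition zero_quat :: quat where "0 = Quat 0 0 0 0"

definition one_quat :: quat where "1 = Quat 1 0 0 0"

definition plus_quat :: "quat \<Rightarrow> quat \<Rightarrow> quat" where
  "x + y = Quat (qre x + qre y) (qim1 x + qim1 y) (qim2 x + qim2 y) (qim3 x + qim3 y)"

definition uminus_quat :: "quat \<Rightarrow> quat" where
  "- x = Quat (- qre x) (- qim1 x) (- qim2 x) (- qim3 x)"

definition minus_quat :: "quat \<Rightarrow> quat \<Rightarrow> quat" where
  "x - y = Quat (qre x - qre y) (qim1 x - qim1 y) (qim2 x - qim2 y) (qim3 x - qim3 y)"

definition times_quat :: "quat \<Rightarrow> quat \<Rightarrow> quat" where
  "x * y = Quat
     (qre x * qre y - qim1 x * qim1 y - qim2 x * qim2 y - qim3 x * qim3 y)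
     (qre x * qim1 y + qim1 x * qre y + qim2 x * qim3 y - qim3 x * qim2 y)
     (qre x * qim2 y - qim1 x * qim3 y + qim2 x * qre y + qim3 x * qim1 y)
     (qre x * qim3 y + qim1 x * qim2 y - qim2 x * qim1 y + qim3 x * qre y)"

definition inverse_quat :: "quat \<Rightarrow> quat" where
  "inverse x = (let r = (qre x)\<^sup>2 + (qim1 x)\<^sup>2 + (qim2 x)\<^sup>2 + (qim3 x)\<^sup>2
     in Quat (qre x / r) (- qim1 x / r) (- qim2 x / r) (- qim3 x / r))"

definition divide_quat :: "quat \<Rightarrow> quat \<Rightarrow> quat" where
  "x div y = x * inverse (y :: quat)"

instance
proof
  fix x :: quat
  assume "x \<noteq> 0"
  hence "0 < (qre x)\<^sup>2 + (qim1 x)\<^sup>2 + (qim2 x)\<^sup>2 + (qim3 x)\<^sup>2"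
    by (auto simp: quat_eq_iff zero_quat_def add_nonneg_pos add_pos_nonneg)
  moreover define r where "r = (qre x)\<^sup>2 + (qim1 x)\<^sup>2 + (qim2 x)\<^sup>2 + (qim3 x)\<^sup>2"
  ultimately have r: "r \<noteq> 0" by simp
  have "(qre x * qre x + qim1 x * qim1 x + qim2 x * qim2 x + qim3 x * qim3 x) / r = 1"
    using r by (metis r_def power2_eq_square divide_self)
  hence 1: "qre x * qre x / r + qim1 x * qim1 x / r + qim2 x * qim2 x / r + qim3 x * qim3 x / r = 1"
    by (simp only: add_divide_distrib)
  show "inverse x * x = 1" "x * inverse x = 1"
    unfolding inverse_quat_def Let_def r_def[symmetric] times_quat_def one_quat_def
    using 1 by (simp_all add: quat_eq_iff mult.commute)
qed (auto simp: zero_quat_def one_quat_def plus_quat_def uminus_quat_def minus_quat_def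
      times_quat_def inverse_quat_def divide_quat_def quat_eq_iff algebra_simps)

end

definition qcnj :: "quat \<Rightarrow> quat" where
  "qcnj x = Quat (qre x) (- qim1 x) (- qim2 x) (- qim3 x)"


section \<open>Reduced norm and reduced trace\<close>

text \<open>
  Writing a quaternion as \<open>z + w j\<close> with complex \<open>z\<close>, \<open>w\<close>, and a quaternionic \<open>n \<times> n\<close> matrix
  accordingly as \<open>Z + W j\<close>, the embedding into the complex \<open>2n \<times> 2n\<close> matrices sends it to the
  block matrix with rows \<open>(Z, W)\<close> and \<open>(- cnj W, cnj Z)\<close>. Reduced norm and reduced trace are the
  determinant and the trace of the image.
\<close>

definition quat_fst :: "quat \<Rightarrow> complex" where
  "quat_fst x = Complex (qre x) (qim1 x)"

definition quat_snd :: "quat \<Rightarrow> complex" where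
  "quat_snd x = Complex (qim2 x) (qim3 x)"

definition complexify :: "quat mat \<Rightarrow> complex mat" where
  "complexify A = four_block_mat
     (map_mat quat_fst A) (map_mat quat_snd A)
     (map_mat (\<lambda>x. - cnj (quat_snd x)) A) (map_mat (\<lambda>x. cnj (quat_fst x)) A)"

definition reduced_norm :: "quat mat \<Rightarrow> complex" where
  "reduced_norm A = det (complexify A)"

definition reduced_trace :: "quat mat \<Rightarrow> complex" where
  "reduced_trace A = sum_list (diag_mat (complexify A))"

definition SL_quat :: "nat \<Rightarrow> quat mat set" where
  "SL_quat n = {g \<in> carrier_mat n n. reduced_norm g = 1}"

definition sl_quat :: "nat \<Rightarrow> quat mat set" where
  "sl_quat n = {z \<in> carrier_mat n n. reduced_trace z = 0}"


section \<open>The group and the Lie algebra\<close>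

definition I_sig :: "nat \<Rightarrow> nat \<Rightarrow> quat mat" where
  "I_sig p q = mat_diag (p + q) (\<lambda>i. if i < p then 1 else - 1)"

definition conj_transpose :: "quat mat \<Rightarrow> quat mat" where
  "conj_transpose A = transpose_mat (map_mat qcnj A)"

definition Sp_group :: "nat \<Rightarrow> nat \<Rightarrow> quat mat monoid" where
  "Sp_group p q =
     \<lparr> carrier = {g \<in> SL_quat (p + q). conj_transpose g * I_sig p q * g = I_sig p q},
       mult = (*), one = 1\<^sub>m (p + q) \<rparr>"

definition sp_algebra :: "nat \<Rightarrow> nat \<Rightarrow> quat mat set" where
  "sp_algebra p q =
     {z \<in> sl_quat (p + q). conj_transpose z * I_sig p q + I_sig p q * z = 0\<^sub>m (p + q) (p + q)}"

text \<open>For a matrix group the adjoint action is conjugation.\<close>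

definition Ad :: "('a :: ring_1) mat monoid \<Rightarrow> 'a mat \<Rightarrow> 'a mat \<Rightarrow> 'a mat" where
  "Ad G g X = g * X * inv\<^bsub>G\<^esub> g"

definition strongly_Ad_real :: "('a :: ring_1) mat monoid \<Rightarrow> 'a mat \<Rightarrow> bool" where
  "strongly_Ad_real G X \<longleftrightarrow> (\<exists>\<tau> \<in> carrier G. \<tau> \<otimes>\<^bsub>G\<^esub> \<tau> = \<one>\<^bsub>G\<^esub> \<and> - X = Ad G \<tau> X)"


section \<open>Nilpotent matrices and their partitions\<close>

definition nilpotent_mat :: "('a :: ring_1) mat \<Rightarrow> bool" where
  "nilpotent_mat X \<longleftrightarrow> (\<exists>k. X ^\<^sub>m k = 0\<^sub>m (dim_row X) (dim_row X))"

text \<open>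
  A partition is the multiset of its parts; the multiplicity \<open>t\<^sub>d\<close> of the part \<open>d\<close> is
  \<open>count N d\<close>.
\<close>

definition partitions :: "nat \<Rightarrow> nat multiset set" where
  "partitions m = {N. 0 \<notin># N \<and> sum_mset N = m}"

definition even_parts :: "nat multiset \<Rightarrow> nat set" where
  "even_parts N = {d \<in> set_mset N. even d}"

text \<open>
  Matrices act from the left on a right vector space, so change of basis is similarity also over a
  skew field. The relation says that the matrix is similar to a direct sum of
  nilpotent Jordan blocks whose sizes, counted with multiplicity, are the parts of \<open>N\<close>.
\<close>

definition jordan_partition :: "('a :: ring_1) mat \<Rightarrow> nat multiset \<Rightarrow> bool" where
  "jordan_partition X N \<longleftrightarrow> (\<exists>ds. mset ds = N \<and> jordan_nf X (map (\<lambda>d. (d, 0)) ds))"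

section \<open>The group axioms\<close>

lemma complexify_carrier:
  "A \<in> carrier_mat n n \<Longrightarrow> complexify A \<in> carrier_mat (n + n) (n + n)"
  unfolding complexify_def by (intro four_block_carrier_mat) auto

lemma quat_fst_sum: "quat_fst (sum f S) = (\<Sum>i\<in>S. quat_fst (f i))"
  by (induction S rule: infinite_finite_induct)
     (auto simp: quat_fst_def zero_quat_def plus_quat_def complex_eq_iff)

lemma quat_snd_sum: "quat_snd (sum f S) = (\<Sum>i\<in>S. quat_snd (f i))"
  by (induction S rule: infinite_finite_induct)
     (auto simp: quat_snd_def zero_quat_def plus_quat_def complex_eq_iff)

lemma quat_fst_mult:
  "quat_fst (x * y) = quat_fst x * quat_fst y - quat_snd x * cnj (quat_snd y)"
  by (simp add: quat_fst_def quat_snd_def times_quat_def complex_eq_iff algebra_simps)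

lemma quat_snd_mult:
  "quat_snd (x * y) = quat_fst x * quat_snd y + quat_snd x * cnj (quat_fst y)"
  by (simp add: quat_fst_def quat_snd_def times_quat_def complex_eq_iff algebra_simps)

lemma complexify_mult:
  assumes A: "A \<in> carrier_mat n n" and B: "B \<in> carrier_mat n n"
  shows "complexify (A * B) = complexify A * complexify B"
proof -
  have "complexify A * complexify B = four_block_mat
     (map_mat quat_fst A * map_mat quat_fst B
        + map_mat quat_snd A * map_mat (\<lambda>x. - cnj (quat_snd x)) B)
     (map_mat quat_fst A * map_mat quat_snd B
        + map_mat quat_snd A * map_mat (\<lambda>x. cnj (quat_fst x)) B)
     (map_mat (\<lambda>x. - cnj (quat_snd x)) A * map_mat quat_fst B
        + map_mat (\<lambda>x. cnj (quat_fst x)) A * map_mat (\<lambda>x. - cnj (quat_snd x)) B)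
     (map_mat (\<lambda>x. - cnj (quat_snd x)) A * map_mat quat_snd B
        + map_mat (\<lambda>x. cnj (quat_fst x)) A * map_mat (\<lambda>x. cnj (quat_fst x)) B)"
    unfolding complexify_def by (rule mult_four_block_mat) (use A B in auto)
  also have "\<dots> = complexify (A * B)"
    unfolding complexify_def
    by (intro arg_cong4[where f = four_block_mat] eq_matI)
       (use A B in \<open>auto simp: scalar_prod_def quat_fst_sum quat_snd_sum quat_fst_mult
          quat_snd_mult sum.distrib sum_negf sum_subtractf\<close>)
  finally show ?thesis ..
qed

lemma complexify_one: "complexify (1\<^sub>m n) = 1\<^sub>m (n + n)"
  unfolding complexify_def
  by (rule eq_matI)
     (auto simp: four_block_mat_def Let_def quat_fst_def quat_snd_def one_quat_def zero_quat_def
        complex_eq_iff)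

lemma complexify_inj:
  assumes A: "A \<in> carrier_mat n n" and B: "B \<in> carrier_mat n n"
    and eq: "complexify A = complexify B"
  shows "A = B"
proof (rule eq_matI)
  fix i j assume "i < dim_row B" "j < dim_col B"
  hence ij: "i < n" "j < n" using B by auto
  have "complexify A $$ (i, j) = complexify B $$ (i, j)"
    "complexify A $$ (i, j + n) = complexify B $$ (i, j + n)" using eq by auto
  with ij A B show "A $$ (i, j) = B $$ (i, j)"
    by (auto simp: complexify_def four_block_mat_def Let_def quat_fst_def quat_snd_def quat_eq_iff)
qed (use A B in auto)

lemma quat_mat_left_right_inverse:
  assumes A: "A \<in> carrier_mat n n" and B: "B \<in> carrier_mat n n" and AB: "A * B = 1\<^sub>m n"
  shows "B * A = (1\<^sub>m n :: quat mat)"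
proof (rule complexify_inj)
  have "complexify A * complexify B = 1\<^sub>m (n + n)"
    using complexify_mult[OF A B] AB complexify_one by simp
  from mat_mult_left_right_inverse[OF complexify_carrier[OF A] complexify_carrier[OF B] this]
  show "complexify (B * A) = complexify (1\<^sub>m n)"
    using complexify_mult[OF B A] complexify_one by simp
qed (use A B in auto)

lemma conj_transpose_mult:
  assumes "A \<in> carrier_mat n n" "B \<in> carrier_mat n n"
  shows "conj_transpose (A * B) = conj_transpose B * conj_transpose A"
proof -
  have s: "qcnj (sum f S) = (\<Sum>i\<in>S. qcnj (f i))" for f :: "nat \<Rightarrow> quat" and S
  proof -
    have a: "qcnj (x + y) = qcnj x + qcnj y" and z: "qcnj 0 = 0" for x y
      by (simp_all add: qcnj_def zero_quat_def plus_quat_def)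
    show ?thesis by (induction S rule: infinite_finite_induct) (simp_all add: a z)
  qed
  have m: "qcnj (x * y) = qcnj y * qcnj x" for x y
    by (simp add: qcnj_def times_quat_def algebra_simps)
  show ?thesis
    by (rule eq_matI)
       (use assms in \<open>auto simp: conj_transpose_def scalar_prod_def s m\<close>)
qed

lemma conj_transpose_carrier:
  "A \<in> carrier_mat n n \<Longrightarrow> conj_transpose A \<in> carrier_mat n n"
  by (simp add: conj_transpose_def)

lemma conj_transpose_one: "conj_transpose (1\<^sub>m n) = 1\<^sub>m n"
  by (rule eq_matI)
     (auto simp: conj_transpose_def qcnj_def one_quat_def zero_quat_def)

lemma I_sig_carrier: "I_sig p q \<in> carrier_mat (p + q) (p + q)"
  by (simp add: I_sig_def)

lemma I_sig_square: "I_sig p q * I_sig p q = 1\<^sub>m (p + q)"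
  unfolding I_sig_def mat_diag_diag
  by (rule eq_matI) (auto simp: mat_diag_def)

lemma group_Sp: "group (Sp_group p q)"
proof (rule groupI)
  let ?n = "p + q" let ?I = "I_sig p q"
  note I = I_sig_carrier[of p q]
  have one: "1\<^sub>m ?n \<in> carrier (Sp_group p q)"
    using I by (simp add: Sp_group_def SL_quat_def reduced_norm_def complexify_one
        conj_transpose_one)
  show "\<one>\<^bsub>Sp_group p q\<^esub> \<in> carrier (Sp_group p q)"
    using one by (simp add: Sp_group_def)
  fix x assume x: "x \<in> carrier (Sp_group p q)"
  hence X: "x \<in> carrier_mat ?n ?n" and nx: "reduced_norm x = 1"
    and fx: "conj_transpose x * ?I * x = ?I"
    by (auto simp: Sp_group_def SL_quat_def)
  note X' = conj_transpose_carrier[OF X]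
  show "\<one>\<^bsub>Sp_group p q\<^esub> \<otimes>\<^bsub>Sp_group p q\<^esub> x = x"
    using X by (simp add: Sp_group_def)
  show "x \<otimes>\<^bsub>Sp_group p q\<^esub> y \<in> carrier (Sp_group p q)"
    if "y \<in> carrier (Sp_group p q)" for y
  proof -
    from that have Y: "y \<in> carrier_mat ?n ?n" and ny: "reduced_norm y = 1"
      and fy: "conj_transpose y * ?I * y = ?I"
      by (auto simp: Sp_group_def SL_quat_def)
    note Y' = conj_transpose_carrier[OF Y]
    have "reduced_norm (x * y) = 1"
      using nx ny det_mult[OF complexify_carrier[OF X] complexify_carrier[OF Y]]
      by (simp add: reduced_norm_def complexify_mult[OF X Y])
    moreover have "conj_transpose (x * y) * ?I * (x * y)
        = conj_transpose y * (conj_transpose x * ?I * x) * y"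
      using X Y X' Y' I by (simp add: conj_transpose_mult[OF X Y] assoc_mult_mat[of _ ?n ?n _ ?n _ ?n])
    ultimately show ?thesis
      using X Y fx fy by (simp add: Sp_group_def SL_quat_def)
  qed
  show "x \<otimes>\<^bsub>Sp_group p q\<^esub> y \<otimes>\<^bsub>Sp_group p q\<^esub> z
      = x \<otimes>\<^bsub>Sp_group p q\<^esub> (y \<otimes>\<^bsub>Sp_group p q\<^esub> z)"
    if "y \<in> carrier (Sp_group p q)" "z \<in> carrier (Sp_group p q)" for y z
    using that X by (auto simp: Sp_group_def SL_quat_def assoc_mult_mat[of _ ?n ?n _ ?n _ ?n])
  show "\<exists>y\<in>carrier (Sp_group p q). y \<otimes>\<^bsub>Sp_group p q\<^esub> x = \<one>\<^bsub>Sp_group p q\<^esub>"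
  proof -
    define y where "y = ?I * conj_transpose x * ?I"
    have Y: "y \<in> carrier_mat ?n ?n" using X' I by (simp add: y_def)
    have "y * x = ?I * (conj_transpose x * ?I * x)"
      using X X' I by (simp add: y_def assoc_mult_mat[of _ ?n ?n _ ?n _ ?n])
    hence yx: "y * x = 1\<^sub>m ?n" using fx I_sig_square by simp
    hence xy: "x * y = 1\<^sub>m ?n" by (rule quat_mat_left_right_inverse[OF Y X])
    note Y' = conj_transpose_carrier[OF Y]
    have "det (complexify y) * det (complexify x) = 1"
      using det_mult[OF complexify_carrier[OF Y] complexify_carrier[OF X]]
        complexify_mult[OF Y X] yx complexify_one by (metis det_one)
    hence "reduced_norm y = 1" using nx by (simp add: reduced_norm_def)
    moreover have "conj_transpose y * ?I * y = conj_transpose y * (conj_transpose x * ?I * x) * y"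
      using fx by simp
    moreover have "\<dots> = conj_transpose (x * y) * ?I * (x * y)"
      using X Y X' Y' I by (simp add: conj_transpose_mult[OF X Y] assoc_mult_mat[of _ ?n ?n _ ?n _ ?n])
    moreover have "\<dots> = ?I" using I by (simp add: xy conj_transpose_one)
    ultimately show ?thesis
      using Y yx by (intro bexI[of _ y]) (auto simp: Sp_group_def SL_quat_def)
  qed
qed

end

theory Submission
  imports Defs
begin

text \<open>
  Strong reality of \<open>X\<close> means that some involution \<open>\<tau>\<close> preserving the Hermitian form anticommutes with
  \<open>X\<close>; involutions over the quaternions have reduced norm \<open>1\<close> automatically. In a Jordan basis of \<open>X\<close>
  the top vectors of the blocks of size \<open>d\<close> span a multiplicity space of dimension \<open>t\<^sub>d\<close>, on which
  \<open>\<langle>v, X\<^bsup>d-1\<^esup> w\<rangle>\<close> is a nondegenerate form, skew-Hermitian for even \<open>d\<close>, and \<open>\<tau>\<close> induces an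
  involution \<open>S\<close> there which multiplies this form by \<open>(-1)\<^bsup>d-1\<^esup>\<close>.

  If \<open>d\<close> is even, \<open>S\<close> negates the form, hence is similar to \<open>- S\<^sup>*\<close> and has real trace \<open>0\<close>. The
  idempotent \<open>(1 + S) / 2\<close> then has real trace \<open>t\<^sub>d / 2\<close>, which must be an integer.

  Conversely, for even \<open>t\<^sub>d\<close> a nondegenerate skew-Hermitian form is congruent to \<open>j I\<close> and is negated
  by an involution; for odd \<open>d\<close> the identity will do. These involutions lift to a map \<open>Y\<close> that
  anticommutes with \<open>X\<close>. Its self-adjoint part \<open>a\<close> still induces them, so \<open>a\<^sup>2\<close> is unipotent, and the
  Newton iteration for the matrix sign function turns \<open>a\<close> into a self-adjoint involution
  anticommuting with \<open>X\<close>.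
\<close>

section \<open>Conjugation on the quaternions and the central copy of the reals\<close>

section \<open>Quaternions\<close>

lemma qre_zero [simp]: "qre 0 = 0" by (simp add: zero_quat_def)
lemma qre_one [simp]: "qre 1 = 1" by (simp add: one_quat_def)
lemma qre_add [simp]: "qre (x + y) = qre x + qre y" by (simp add: plus_quat_def)
lemma qre_uminus [simp]: "qre (- x) = - qre x" by (simp add: uminus_quat_def)
lemma qre_mult_commute: "qre (x * y) = qre (y * x)" by (simp add: times_quat_def)
lemma qre_sum: "qre (sum f S) = (\<Sum>i\<in>S. qre (f i))"
  by (induction S rule: infinite_finite_induct) auto

lemma qcnj_zero [simp]: "qcnj 0 = 0" by (simp add: qcnj_def zero_quat_def)
lemma qcnj_one [simp]: "qcnj 1 = 1" by (simp add: qcnj_def one_quat_def)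
lemma qcnj_add [simp]: "qcnj (x + y) = qcnj x + qcnj y" by (simp add: qcnj_def plus_quat_def)
lemma qcnj_uminus [simp]: "qcnj (- x) = - qcnj x" by (simp add: qcnj_def uminus_quat_def)
lemma qcnj_mult [simp]: "qcnj (x * y) = qcnj y * qcnj x"
  by (simp add: qcnj_def times_quat_def algebra_simps)
lemma qcnj_qcnj [simp]: "qcnj (qcnj x) = x" by (simp add: qcnj_def)
lemma qre_qcnj [simp]: "qre (qcnj x) = qre x" by (simp add: qcnj_def)
lemma qcnj_sum: "qcnj (sum f S) = (\<Sum>i\<in>S. qcnj (f i))"
  by (induction S rule: infinite_finite_induct) auto
lemma qcnj_eq_0_iff [simp]: "qcnj x = 0 \<longleftrightarrow> x = 0"
  by (metis qcnj_qcnj qcnj_zero)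

lemma qcnj_power_minus_one [simp]: "qcnj ((- 1) ^ k) = (- 1) ^ k"
  by (induction k) auto

definition quat_of_real :: "real \<Rightarrow> quat" where
  "quat_of_real r = Quat r 0 0 0"

lemma quat_of_real_commute: "x * quat_of_real r = quat_of_real r * x"
  by (simp add: quat_of_real_def times_quat_def)
lemma quat_of_real_add: "quat_of_real r + quat_of_real s = quat_of_real (r + s)"
  by (simp add: quat_of_real_def plus_quat_def)
lemma quat_of_real_1 [simp]: "quat_of_real 1 = 1"
  by (simp add: quat_of_real_def one_quat_def)
lemma qcnj_quat_of_real [simp]: "qcnj (quat_of_real r) = quat_of_real r"
  by (simp add: quat_of_real_def qcnj_def)
lemma qre_quat_of_real_mult [simp]: "qre (quat_of_real r * x) = r * qre x"
  by (simp add: quat_of_real_def times_quat_def)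

section \<open>Adjoints, real traces, ranks of idempotents, and the reduced norm of an
  involution\<close>

section \<open>Quaternionic matrices\<close>

subsection \<open>Conjugate transposes and real traces\<close>

lemma dim_conj_transpose [simp]:
  "dim_row (conj_transpose A) = dim_col A" "dim_col (conj_transpose A) = dim_row A"
  by (simp_all add: conj_transpose_def)

lemma conj_transpose_carrier_iff [simp]:
  "conj_transpose A \<in> carrier_mat n m \<longleftrightarrow> A \<in> carrier_mat m n"
  unfolding carrier_mat_def mem_Collect_eq dim_conj_transpose by (rule conj_commute)

lemma conj_transpose_index [simp]:
  "i < dim_col A \<Longrightarrow> j < dim_row A \<Longrightarrow> conj_transpose A $$ (i, j) = qcnj (A $$ (j, i))"
  by (simp add: conj_transpose_def)

lemma conj_transpose_conj_transpose [simp]: "conj_transpose (conj_transpose A) = A"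
  by (rule eq_matI) auto

lemma conj_transpose_uminus [simp]: "conj_transpose (- A) = - conj_transpose A"
  by (rule eq_matI) auto

lemma conj_transpose_add:
  "A \<in> carrier_mat n m \<Longrightarrow> B \<in> carrier_mat n m \<Longrightarrow>
   conj_transpose (A + B) = conj_transpose A + conj_transpose B"
  by (rule eq_matI) auto

lemma mat_mult_index:
  assumes "A \<in> carrier_mat n m" "B \<in> carrier_mat m k" "i < n" "j < k"
  shows "(A * B) $$ (i, j) = (\<Sum>l<m. A $$ (i, l) * B $$ (l, j))"
  using assms by (auto simp: scalar_prod_def lessThan_atLeast0 intro!: sum.cong)

lemma conj_transpose_mult_rect:
  assumes "A \<in> carrier_mat n m" "B \<in> carrier_mat m k"
  shows "conj_transpose (A * B) = conj_transpose B * conj_transpose A"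
  by (rule eq_matI) (use assms in \<open>auto simp: scalar_prod_def qcnj_sum intro!: sum.cong\<close>)

text \<open>The ring laws with conditions on dimensions only, which the simplifier can discharge without
  guessing the inner dimensions of products.\<close>

lemma mat_assoc:
  fixes A :: "'a :: semiring_0 mat"
  shows "dim_col A = dim_row B \<Longrightarrow> dim_col B = dim_row C \<Longrightarrow> A * B * C = A * (B * C)"
  by (rule assoc_mult_mat[of A "dim_row A" "dim_row B" _ "dim_row C" _ "dim_col C"]) (auto intro: carrier_matI)

lemma mat_distrib_left:
  fixes A :: "'a :: semiring_0 mat"
  shows "dim_col A = dim_row B \<Longrightarrow> dim_row B = dim_row C \<Longrightarrow> dim_col B = dim_col C \<Longrightarrow>
    A * (B + C) = A * B + A * C"
  by (rule mult_add_distrib_mat[of A "dim_row A" "dim_row B" _ "dim_col C"]) (auto intro: carrier_matI)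

lemma mat_distrib_right:
  fixes A :: "'a :: semiring_0 mat"
  shows "dim_col A = dim_row C \<Longrightarrow> dim_row A = dim_row B \<Longrightarrow> dim_col A = dim_col B \<Longrightarrow>
    (A + B) * C = A * C + B * C"
  by (rule add_mult_distrib_mat[of A "dim_row A" "dim_col A" _ _ "dim_col C"]) (auto intro: carrier_matI)

lemma mat_conj_transpose_mult:
  "dim_col A = dim_row B \<Longrightarrow> conj_transpose (A * B) = conj_transpose B * conj_transpose A"
  by (rule conj_transpose_mult_rect[of A "dim_row A" "dim_col A" _ "dim_col B"]) (auto intro: carrier_matI)

lemma mat_conj_transpose_add:
  "dim_row A = dim_row B \<Longrightarrow> dim_col A = dim_col B \<Longrightarrow>
    conj_transpose (A + B) = conj_transpose A + conj_transpose B"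
  by (rule conj_transpose_add[of A "dim_row A" "dim_col A"]) (auto intro: carrier_matI)

lemma mat_uminus_add:
  fixes A :: "'a :: ab_group_add mat"
  shows "dim_row A = dim_row B \<Longrightarrow> dim_col A = dim_col B \<Longrightarrow> - (A + B) = - A + - B"
  by (rule eq_matI) auto

lemma mat_add_uminus:
  "dim_row A = n \<Longrightarrow> dim_col A = m \<Longrightarrow> A + - A = (0\<^sub>m n m :: 'a :: group_add mat)"
  by (rule eq_matI) auto

lemmas mat_algebra = mat_assoc mat_distrib_left mat_distrib_right mat_conj_transpose_mult
  mat_conj_transpose_add mat_uminus_add mat_add_uminus conj_transpose_one

text \<open>Over the quaternions only the real part of a trace is cyclically invariant, because
  \<open>qre (x * y) = qre (y * x)\<close>. It is half of the reduced trace.\<close>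

definition real_trace :: "quat mat \<Rightarrow> real" where
  "real_trace A = (\<Sum>i<dim_row A. qre (A $$ (i, i)))"

lemma real_trace_commute:
  assumes A: "A \<in> carrier_mat n m" and B: "B \<in> carrier_mat m n"
  shows "real_trace (A * B) = real_trace (B * A)"
proof -
  have "real_trace (A * B) = (\<Sum>i<n. \<Sum>l<m. qre (A $$ (i, l) * B $$ (l, i)))"
    using A by (simp add: real_trace_def mat_mult_index[OF A B] qre_sum del: index_mult_mat(1))
  also have "\<dots> = (\<Sum>l<m. \<Sum>i<n. qre (B $$ (l, i) * A $$ (i, l)))"
    by (subst sum.swap) (simp add: qre_mult_commute)
  also have "\<dots> = real_trace (B * A)"
    using B by (simp add: real_trace_def mat_mult_index[OF B A] qre_sum del: index_mult_mat(1))
  finally show ?thesis .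
qed

lemma real_trace_add:
  "A \<in> carrier_mat n n \<Longrightarrow> B \<in> carrier_mat n n \<Longrightarrow> real_trace (A + B) = real_trace A + real_trace B"
  by (auto simp: real_trace_def sum.distrib)

lemma real_trace_uminus: "A \<in> carrier_mat n n \<Longrightarrow> real_trace (- A) = - real_trace A"
  by (auto simp: real_trace_def sum_negf)

lemma real_trace_one [simp]: "real_trace (1\<^sub>m n) = real n"
  by (simp add: real_trace_def)

lemma real_trace_conj_transpose:
  "A \<in> carrier_mat n n \<Longrightarrow> real_trace (conj_transpose A) = real_trace A"
  by (auto simp: real_trace_def)

subsection \<open>Real scalars\<close>

text \<open>Scaling acts on entries from the left. Restricting it to real scalars, which are
  central, makes it compatible with products on both sides and with conjugate transposition.\<close>

definition rscale :: "real \<Rightarrow> quat mat \<Rightarrow> quat mat" where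
  "rscale r A = quat_of_real r \<cdot>\<^sub>m A"

lemma dim_rscale [simp]: "dim_row (rscale r A) = dim_row A" "dim_col (rscale r A) = dim_col A"
  by (simp_all add: rscale_def)

lemma rscale_carrier [simp]: "rscale r A \<in> carrier_mat n m \<longleftrightarrow> A \<in> carrier_mat n m"
  unfolding carrier_mat_def by simp

lemma rscale_index [simp]:
  "i < dim_row A \<Longrightarrow> j < dim_col A \<Longrightarrow> rscale r A $$ (i, j) = quat_of_real r * A $$ (i, j)"
  by (simp add: rscale_def)

lemma rscale_mult_left:
  "A \<in> carrier_mat n m \<Longrightarrow> B \<in> carrier_mat m k \<Longrightarrow> rscale r A * B = rscale r (A * B)"
  by (rule eq_matI)
     (auto simp: mat_mult_index[of _ n m _ k] sum_distrib_left mult.assoc simp del: index_mult_mat(1)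
       intro!: sum.cong)

lemma rscale_mult_right:
  "A \<in> carrier_mat n m \<Longrightarrow> B \<in> carrier_mat m k \<Longrightarrow> A * rscale r B = rscale r (A * B)"
  by (rule eq_matI)
     (auto simp: mat_mult_index[of _ n m _ k] sum_distrib_left mult.assoc[symmetric] quat_of_real_commute
       simp del: index_mult_mat(1) intro!: sum.cong)

lemma rscale_add: "A \<in> carrier_mat n m \<Longrightarrow> B \<in> carrier_mat n m \<Longrightarrow>
    rscale r (A + B) = rscale r A + rscale r B"
  by (rule eq_matI) (auto simp: distrib_left)

lemma rscale_uminus: "rscale r (- A) = - rscale r A"
  by (rule eq_matI) auto

lemma rscale_half_double: "rscale (1/2) A + rscale (1/2) A = A"
  by (rule eq_matI) (auto simp: distrib_right[symmetric] quat_of_real_add)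

lemma conj_transpose_rscale: "conj_transpose (rscale r A) = rscale r (conj_transpose A)"
  by (rule eq_matI) (auto simp: quat_of_real_commute)

lemma real_trace_rscale: "A \<in> carrier_mat n n \<Longrightarrow> real_trace (rscale r A) = r * real_trace A"
  by (auto simp: real_trace_def sum_distrib_left)

subsection \<open>Idempotents over a division ring\<close>

text \<open>Subtracting the rank-one idempotent spanned by a nonzero entry kills a row and keeps the
  zero rows, so that the number of nonzero rows is a termination measure.\<close>

lemma idempotent_mat_split:
  fixes E :: "'a :: division_ring mat"
  assumes "E \<in> carrier_mat n n" "E * E = E"
  shows "\<exists>r A B. A \<in> carrier_mat n r \<and> B \<in> carrier_mat r n \<and> A * B = E \<and> B * A = 1\<^sub>m r"
  using assms
proof (induction "card {i. i < n \<and> (\<exists>j<n. E $$ (i, j) \<noteq> 0)}" arbitrary: E rule: less_induct)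
  case less
  note E = less.prems
  show ?case
  proof (cases "E = 0\<^sub>m n n")
    case True
    show ?thesis
      by (rule exI[of _ 0], rule exI[of _ "0\<^sub>m n 0"], rule exI[of _ "0\<^sub>m 0 n"])
         (auto simp: True intro!: eq_matI)
  next
    case False
    then obtain p q where pq: "p < n" "q < n" "E $$ (p, q) \<noteq> 0"
      using E(1) by (metis carrier_matD eq_matI index_zero_mat)
    define e where "e = E $$ (p, q)"
    define u where "u = mat n 1 (\<lambda>(i, _). E $$ (i, q))"
    \<comment> \<open>\<open>u\<close> is the pivot column and \<open>f\<close> the pivot row,
      scaled on the left so that \<open>f * u = 1\<close>. Idempotence of \<open>E\<close> gives
      \<open>E * u = u\<close> and \<open>f * E = f\<close>, so \<open>u * f\<close> is an
      idempotent absorbed by \<open>E\<close> on both sides.\<close>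
    define f where "f = mat 1 n (\<lambda>(_, j). inverse e * E $$ (p, j))"
    have u: "u \<in> carrier_mat n 1" and f: "f \<in> carrier_mat 1 n" by (simp_all add: u_def f_def)
    have EE: "(\<Sum>l<n. E $$ (i, l) * E $$ (l, j)) = E $$ (i, j)" if "i < n" "j < n" for i j
      using mat_mult_index[OF E(1) E(1) that] E(2) by simp
    have Eu: "E * u = u"
      by (rule eq_matI)
         (use E(1) EE pq in \<open>auto simp: u_def mat_mult_index[OF E(1), of _ 1] simp del: index_mult_mat(1)\<close>)
    have fE: "f * E = f"
      by (rule eq_matI)
         (use E(1) EE pq in \<open>auto simp: f_def mat_mult_index[OF _ E(1), of _ 1] mult.assoc
             sum_distrib_left[symmetric] simp del: index_mult_mat(1)\<close>)
    have fu: "f * u = 1\<^sub>m 1"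
      by (rule eq_matI)
         (use E(1) EE pq in \<open>auto simp: f_def u_def mat_mult_index[of _ 1 n _ 1] mult.assoc
             sum_distrib_left[symmetric] e_def simp del: index_mult_mat(1)\<close>)
    define E' where "E' = E - u * f"
    have uf: "u * f \<in> carrier_mat n n" using u f by simp
    have E': "E' \<in> carrier_mat n n" unfolding E'_def by (rule minus_carrier_mat[OF uf])
    have 1: "E * (u * f) = u * f" using E(1) u f Eu by (simp flip: assoc_mult_mat[of _ n n _ 1 _ n])
    have 2: "u * f * E = u * f" using E(1) u f fE by (simp add: assoc_mult_mat[of _ n 1 _ n _ n])
    have E'u: "E' * u = 0\<^sub>m n 1"
      using E(1) u f uf Eu fu by (simp add: E'_def minus_mult_distrib_mat[of _ n n] assoc_mult_mat[of _ n 1 _ n _ 1])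
    have fE': "f * E' = 0\<^sub>m 1 n"
      using E(1) u f uf fE fu by (simp add: E'_def mult_minus_distrib_mat[of _ _ n] flip: assoc_mult_mat[of _ 1 n _ 1 _ n])
    have idem: "E' * E' = E'"
    proof -
      have "E' * E' = E' * E - E' * (u * f)"
        using E(1) uf E' by (subst (2) E'_def) (rule mult_minus_distrib_mat)
      also have "E' * E = E'"
        using E uf 2 by (simp add: E'_def minus_mult_distrib_mat[of _ n n])
      also have "E' * (u * f) = 0\<^sub>m n n"
        using E' u f E'u by (simp flip: assoc_mult_mat[of _ n n _ 1 _ n])
      finally show ?thesis using E' by auto
    qed
    have E'_index: "E' $$ (i, j) = E $$ (i, j) - E $$ (i, q) * (inverse e * E $$ (p, j))"
      if "i < n" "j < n" for i j
      using that E(1) u f by (simp add: E'_def u_def f_def scalar_prod_def)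
    let ?R = "\<lambda>E :: 'a mat. {i. i < n \<and> (\<exists>j<n. E $$ (i, j) \<noteq> 0)}"
    have "?R E' \<subset> ?R E"
    proof (rule psubsetI)
      show "?R E' \<subseteq> ?R E"
      proof
        fix i assume "i \<in> ?R E'"
        then obtain j where ij: "i < n" "j < n" "E' $$ (i, j) \<noteq> 0" by blast
        hence "E $$ (i, j) \<noteq> 0 \<or> E $$ (i, q) \<noteq> 0" using E'_index by force
        thus "i \<in> ?R E" using ij pq by blast
      qed
      have "p \<in> ?R E" using pq by blast
      moreover have "p \<notin> ?R E'"
      proof -
        have "E' $$ (p, j) = 0" if "j < n" for j
          using that pq by (simp add: E'_index e_def[symmetric] mult.assoc[symmetric])
        thus ?thesis by blast
      qed
      ultimately show "?R E' \<noteq> ?R E" by blast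
    qed
    hence "card (?R E') < card (?R E)" by (intro psubset_card_mono) auto
    from less.hyps[OF this E' idem] obtain r A B where
      A: "A \<in> carrier_mat n r" and B: "B \<in> carrier_mat r n" and AB: "A * B = E'" and BA: "B * A = 1\<^sub>m r"
      by blast
    \<comment> \<open>\<open>A\<close> and \<open>B\<close> factor through \<open>E'\<close>, which
      is annihilated by \<open>f\<close> from the left and by \<open>u\<close> from the right. Hence
      the cross terms vanish once \<open>u\<close> is prepended to \<open>A\<close> as a column and
      \<open>f\<close> to \<open>B\<close> as a row.\<close>
    have "E' * A = A" using A B BA by (simp add: AB[symmetric] assoc_mult_mat[of _ n r _ n _ r])
    hence "f * A = f * E' * A" using f E' A by (simp add: assoc_mult_mat[of _ 1 n _ n _ r])
    hence fA: "f * A = 0\<^sub>m 1 r" using fE' A by simp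
    have "B * E' = B" using A B BA by (simp add: AB[symmetric] flip: assoc_mult_mat[of _ r n _ r _ n])
    hence "B * u = B * (E' * u)" using B E' u by (simp flip: assoc_mult_mat[of _ r n _ n _ 1])
    hence Bu: "B * u = 0\<^sub>m r 1" using E'u B by simp
    define A' where "A' = mat n (Suc r) (\<lambda>(i, a). case a of 0 \<Rightarrow> u $$ (i, 0) | Suc b \<Rightarrow> A $$ (i, b))"
    define B' where "B' = mat (Suc r) n (\<lambda>(a, j). case a of 0 \<Rightarrow> f $$ (0, j) | Suc b \<Rightarrow> B $$ (b, j))"
    have A': "A' \<in> carrier_mat n (Suc r)" and B': "B' \<in> carrier_mat (Suc r) n"
      by (simp_all add: A'_def B'_def)
    have "A' * B' = E"
    proof (rule eq_matI)
      fix i j assume "i < dim_row E" "j < dim_col E"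
      hence ij: "i < n" "j < n" using E(1) by auto
      have "(A' * B') $$ (i, j) = (\<Sum>a<Suc r. A' $$ (i, a) * B' $$ (a, j))"
        using ij by (rule mat_mult_index[OF A' B'])
      also have "\<dots> = u $$ (i, 0) * f $$ (0, j) + (\<Sum>a<r. A $$ (i, a) * B $$ (a, j))"
        unfolding sum.lessThan_Suc_shift using ij by (simp add: A'_def B'_def)
      also have "\<dots> = (u * f) $$ (i, j) + (A * B) $$ (i, j)"
        using ij by (simp add: mat_mult_index[OF u f] mat_mult_index[OF A B] del: index_mult_mat(1))
      also have "\<dots> = E $$ (i, j)" unfolding AB E'_def using ij E(1) u f
        by (subst index_minus_mat) auto
      finally show "(A' * B') $$ (i, j) = E $$ (i, j)" .
    qed (use A' B' E in auto)
    moreover have "B' * A' = 1\<^sub>m (Suc r)"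
    proof (rule eq_matI)
      fix a b assume ab: "a < dim_row (1\<^sub>m (Suc r))" "b < dim_col (1\<^sub>m (Suc r))"
      have fu': "(f * u) $$ (0, 0) = 1" using fu by simp
      have fA': "(f * A) $$ (0, b) = 0" if "b < r" for b using fA that by simp
      have Bu': "(B * u) $$ (a, 0) = 0" if "a < r" for a using Bu that by simp
      have BA': "(B * A) $$ (a, b) = (if a = b then 1 else 0)" if "a < r" "b < r" for a b using BA that by simp
      have "(B' * A') $$ (a, b) = (\<Sum>l<n. B' $$ (a, l) * A' $$ (l, b))"
        using ab by (intro mat_mult_index[OF B' A']) auto
      also have "\<dots> = 1\<^sub>m (Suc r) $$ (a, b)"
        using ab fu' fA'[of "b - 1"] Bu'[of "a - 1"] BA'[of "a - 1" "b - 1"]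
        by (cases a; cases b)
          (simp_all add: mat_mult_index[OF f u] mat_mult_index[OF f A]
            mat_mult_index[OF B u] mat_mult_index[OF B A] A'_def B'_def del: index_mult_mat(1))
      finally show "(B' * A') $$ (a, b) = 1\<^sub>m (Suc r) $$ (a, b)" .
    qed (use A' B' in auto)
    ultimately show ?thesis using A' B' by blast
  qed
qed

text \<open>Cyclic invariance applied to \<open>E = A * B\<close> with \<open>B * A = 1\<close>
  identifies the trace with the rank \<open>r\<close>.\<close>

lemma idempotent_real_trace:
  assumes E: "E \<in> carrier_mat n n" and "E * E = E"
  obtains r :: nat where "real_trace E = real r"
proof -
  from idempotent_mat_split[OF assms] obtain r A B where
    A: "A \<in> carrier_mat n r" and B: "B \<in> carrier_mat r n" and "A * B = E" "B * A = 1\<^sub>m r" by blast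
  with real_trace_commute[OF A B] show ?thesis using that by simp
qed

subsection \<open>Quaternionic involutions have reduced norm one\<close>

text \<open>The rectangular case serves the factors of an idempotent, whose inner dimension is the
  rank.\<close>

lemma complexify_mult_rect:
  assumes A: "A \<in> carrier_mat n m" and B: "B \<in> carrier_mat m k"
  shows "complexify (A * B) = complexify A * complexify B"
proof -
  have "complexify A * complexify B = four_block_mat
     (map_mat quat_fst A * map_mat quat_fst B
        + map_mat quat_snd A * map_mat (\<lambda>x. - cnj (quat_snd x)) B)
     (map_mat quat_fst A * map_mat quat_snd B
        + map_mat quat_snd A * map_mat (\<lambda>x. cnj (quat_fst x)) B)
     (map_mat (\<lambda>x. - cnj (quat_snd x)) A * map_mat quat_fst B
        + map_mat (\<lambda>x. cnj (quat_fst x)) A * map_mat (\<lambda>x. - cnj (quat_snd x)) B)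
     (map_mat (\<lambda>x. - cnj (quat_snd x)) A * map_mat quat_snd B
        + map_mat (\<lambda>x. cnj (quat_fst x)) A * map_mat (\<lambda>x. cnj (quat_fst x)) B)"
    unfolding complexify_def by (rule mult_four_block_mat) (use A B in auto)
  also have "\<dots> = complexify (A * B)"
    unfolding complexify_def
    by (intro arg_cong4[where f = four_block_mat] eq_matI)
       (use A B in \<open>auto simp: scalar_prod_def quat_fst_sum quat_snd_sum quat_fst_mult
          quat_snd_mult sum.distrib sum_negf sum_subtractf\<close>)
  finally show ?thesis ..
qed

lemma complexify_diff:
  assumes "A \<in> carrier_mat n m" "B \<in> carrier_mat n m"
  shows "complexify (A - B) = complexify A - complexify B"
  by (rule eq_matI)
     (use assms in \<open>auto simp: complexify_def four_block_mat_def Let_def quat_fst_def quat_snd_def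
        minus_quat_def complex_eq_iff\<close>)

lemma complexify_add:
  assumes "A \<in> carrier_mat n m" "B \<in> carrier_mat n m"
  shows "complexify (A + B) = complexify A + complexify B"
  by (rule eq_matI)
     (use assms in \<open>auto simp: complexify_def four_block_mat_def Let_def quat_fst_def quat_snd_def
        plus_quat_def complex_eq_iff\<close>)

lemma complexify_carrier_rect:
  "A \<in> carrier_mat n m \<Longrightarrow> complexify A \<in> carrier_mat (n + n) (m + m)"
  unfolding complexify_def by (intro four_block_carrier_mat) auto

text \<open>Sylvester's identity. The block matrix with rows \<open>(1, A)\<close> and
  \<open>(B, 1)\<close> is factored with the unitriangular \<open>?L\<close> once on the left and
  once on the right; the other factors have the two determinants.\<close>

lemma det_one_minus_mult_commute:
  fixes A B :: "'a :: idom mat"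
  assumes A: "A \<in> carrier_mat n r" and B: "B \<in> carrier_mat r n"
  shows "det (1\<^sub>m n - A * B) = det (1\<^sub>m r - B * A)"
proof -
  have AB: "A * B \<in> carrier_mat n n" and BA: "B * A \<in> carrier_mat r r" using A B by auto
  let ?L = "four_block_mat (1\<^sub>m n) (0\<^sub>m n r) B (1\<^sub>m r)"
  let ?M = "four_block_mat (1\<^sub>m n) A B (1\<^sub>m r)"
  have c: "?L \<in> carrier_mat (n + r) (n + r)" using A B by (intro four_block_carrier_mat) auto
  have c2: "four_block_mat (1\<^sub>m n - A * B) A (0\<^sub>m r n) (1\<^sub>m r) \<in> carrier_mat (n + r) (n + r)"
    "four_block_mat (1\<^sub>m n) A (0\<^sub>m r n) (1\<^sub>m r - B * A) \<in> carrier_mat (n + r) (n + r)"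
    using AB BA A B by (auto intro!: four_block_carrier_mat minus_carrier_mat)
  have "?L * four_block_mat (1\<^sub>m n) A (0\<^sub>m r n) (1\<^sub>m r - B * A) = ?M"
    by (subst mult_four_block_mat[of _ n n _ r _ r _ _ n _ r])
       (use A B AB BA in \<open>auto intro!: arg_cong4[where f = four_block_mat]\<close>)
  moreover have "four_block_mat (1\<^sub>m n - A * B) A (0\<^sub>m r n) (1\<^sub>m r) * ?L = ?M"
    by (subst mult_four_block_mat[of _ n n _ r _ r _ _ n _ r])
       (use A B AB BA in \<open>auto intro!: arg_cong4[where f = four_block_mat]\<close>)
  ultimately have "det ?L * det (four_block_mat (1\<^sub>m n) A (0\<^sub>m r n) (1\<^sub>m r - B * A))
      = det (four_block_mat (1\<^sub>m n - A * B) A (0\<^sub>m r n) (1\<^sub>m r)) * det ?L"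
    using det_mult[OF c c2(2)] det_mult[OF c2(1) c] by simp
  moreover have "det ?L = 1"
    using A B by (subst det_four_block_mat_upper_right_zero[of _ n _ r]) auto
  moreover have "det (four_block_mat (1\<^sub>m n) A (0\<^sub>m r n) (1\<^sub>m r - B * A)) = det (1\<^sub>m r - B * A)"
    using A B BA by (subst det_four_block_mat_lower_left_zero[of _ n _ r]) auto
  moreover have "det (four_block_mat (1\<^sub>m n - A * B) A (0\<^sub>m r n) (1\<^sub>m r)) = det (1\<^sub>m n - A * B)"
    using A B AB by (subst det_four_block_mat_lower_left_zero[of _ n _ r]) auto
  ultimately show ?thesis by simp
qed

lemma idempotent_of_involution:
  assumes T: "T \<in> carrier_mat n n" and TT: "T * T = (1\<^sub>m n :: quat mat)"
  shows "rscale (1/2) (1\<^sub>m n + T) * rscale (1/2) (1\<^sub>m n + T) = rscale (1/2) (1\<^sub>m n + T)"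
proof -
  have c: "1\<^sub>m n + T \<in> carrier_mat n n" using T by simp
  have "(1\<^sub>m n + T) * (1\<^sub>m n + T) = (1\<^sub>m n + T) + (1\<^sub>m n + T)"
    using T TT by (simp add: add_mult_distrib_mat[of _ n n _ _ n] mult_add_distrib_mat[of _ n n _ n]
        comm_add_mat[of T n n])
  hence "rscale (1/2) (1\<^sub>m n + T) * rscale (1/2) (1\<^sub>m n + T)
      = rscale (1/2) (rscale (1/2) ((1\<^sub>m n + T) + (1\<^sub>m n + T)))"
    using c by (simp add: rscale_mult_left[of _ n n] rscale_mult_right[of _ n n])
  also have "\<dots> = rscale (1/2) (1\<^sub>m n + T)"
    using c by (simp add: rscale_add[of _ n n] rscale_half_double)
  finally show ?thesis .
qed

text \<open>The idempotent \<open>(1 - T) / 2\<close> splits as \<open>A * B\<close> with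
  \<open>B * A = 1\<close> of size \<open>r\<close>, so \<open>T = 1 - 2 A B\<close>. After
  complexification Sylvester's identity leaves the determinant of \<open>- 1\<close> in the even
  size \<open>r + r\<close>.\<close>

lemma reduced_norm_involution:
  assumes T: "T \<in> carrier_mat n n" and TT: "T * T = 1\<^sub>m n"
  shows "reduced_norm T = 1"
proof -
  let ?E = "rscale (1/2) (1\<^sub>m n + (- T))"
  have "- T \<in> carrier_mat n n" "(- T) * (- T) = 1\<^sub>m n" using T TT by simp_all
  note idem = idempotent_of_involution[OF this]
  have "?E \<in> carrier_mat n n" using T by simp
  from idempotent_mat_split[OF this idem] obtain r A B where
    A: "A \<in> carrier_mat n r" and B: "B \<in> carrier_mat r n" and AB: "A * B = ?E" and BA: "B * A = 1\<^sub>m r"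
    by blast
  have AA: "A + A \<in> carrier_mat n r" using A by simp
  have "(A + A) * B = ?E + ?E" using A B AB by (simp add: add_mult_distrib_mat[of _ n r])
  hence "(A + A) * B = 1\<^sub>m n + (- T)" by (simp add: rscale_half_double)
  hence "1\<^sub>m n - (A + A) * B = T" using T by (intro eq_matI) auto
  hence "complexify T = 1\<^sub>m (n + n) - complexify (A + A) * complexify B"
    using complexify_diff[of "1\<^sub>m n" n n "(A + A) * B"] AA B
    by (simp add: complexify_one complexify_mult_rect[OF AA B])
  hence "reduced_norm T = det (1\<^sub>m (r + r) - complexify B * complexify (A + A))"
    using det_one_minus_mult_commute[OF complexify_carrier_rect[OF AA] complexify_carrier_rect[OF B]]
    by (simp add: reduced_norm_def)
  also have "complexify B * complexify (A + A) = complexify (1\<^sub>m r + 1\<^sub>m r)"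
    using A B AA BA by (simp add: mult_add_distrib_mat[of _ r n] flip: complexify_mult_rect[OF B AA])
  also have "\<dots> = 1\<^sub>m (r + r) + 1\<^sub>m (r + r)"
    using complexify_add[of "1\<^sub>m r" r r "1\<^sub>m r"] by (simp add: complexify_one)
  also have "1\<^sub>m (r + r) - (1\<^sub>m (r + r) + 1\<^sub>m (r + r)) = (- 1 :: complex) \<cdot>\<^sub>m 1\<^sub>m (r + r)"
    by (rule eq_matI) auto
  also have "det \<dots> = (1 :: complex)" by (subst det_smult) (simp add: uminus_power_if)
  finally show ?thesis .
qed

section \<open>Normal form of nondegenerate skew-Hermitian forms, and involutions negating
  them\<close>

section \<open>Skew-Hermitian forms over the quaternions\<close>

definition qi :: quat where "qi = Quat 0 1 0 0"
definition qj :: quat where "qj = Quat 0 0 1 0"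

lemma qi_qi: "qi * qi = - 1" and qj_qj: "qj * qj = - 1" and qj_qi: "qj * qi = - (qi * qj)"
  by (simp_all add: qi_def qj_def times_quat_def one_quat_def uminus_quat_def)

lemma qcnj_qi [simp]: "qcnj qi = - qi" and qcnj_qj [simp]: "qcnj qj = - qj"
  by (simp_all add: qi_def qj_def qcnj_def uminus_quat_def)

lemma qi_neq_0 [simp]: "qi \<noteq> 0" and qj_neq_0 [simp]: "qj \<noteq> 0"
  by (simp_all add: qi_def qj_def zero_quat_def)

lemma quat_double_eq_0: "(x :: quat) + x = 0 \<Longrightarrow> x = 0"
  by (simp add: quat_eq_iff plus_quat_def zero_quat_def)

text \<open>Conjugation rotates imaginary directions transitively and a real factor adjusts the
  length. Hence nonzero skew-Hermitian forms in one variable have no invariant, not even a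
  sign.\<close>

lemma imaginary_quat_congruent_qj:
  assumes "qcnj c = - c" "c \<noteq> 0"
  obtains q where "qcnj q * c * q = qj"
proof -
  from assms(1) have c0: "qre c = 0" by (simp add: qcnj_def uminus_quat_def quat_eq_iff)
  obtain x y z where c: "c = Quat 0 x y z" using c0 by (cases c) auto
  define N where "N = sqrt (x\<^sup>2 + y\<^sup>2 + z\<^sup>2)"
  have N2: "N * N = x * x + y * y + z * z" by (simp add: N_def power2_eq_square)
  have "N \<noteq> 0" using assms(2) by (simp add: N_def c zero_quat_def add_nonneg_eq_0_iff)
  moreover have "N \<ge> 0" by (simp add: N_def)
  ultimately have N: "N > 0" by simp
  \<comment> \<open>\<open>c (c + N j) = N (c + N j) j\<close>, so \<open>c + N j\<close> conjugates \<open>c\<close> into \<open>N j\<close> unless it vanishes.\<close>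
  obtain p s where p: "qcnj p * c * p = quat_of_real s * qj" "s > 0"
  proof (cases "x = 0 \<and> z = 0 \<and> y \<le> 0")
    case True
    hence "y < 0" using assms(2) c by (auto simp: zero_quat_def)
    \<comment> \<open>Here \<open>c\<close> is a negative multiple of \<open>j\<close> and
      \<open>c + N j\<close> vanishes; conjugation by \<open>i\<close> reverses the sign of
      \<open>j\<close>.\<close>
    have "qcnj qi * c * qi = quat_of_real (- y) * qj"
      using True by (simp add: c qi_def qj_def qcnj_def times_quat_def quat_of_real_def)
    with \<open>y < 0\<close> that[of qi "- y"] show ?thesis by simp
  next
    case False
    let ?p = "Quat 0 x (y + N) z"
    have yN: "y + N \<noteq> 0 \<or> x \<noteq> 0 \<or> z \<noteq> 0"
      using False N by auto
    have "qcnj ?p * c * ?p = quat_of_real (N * (x\<^sup>2 + (y + N)\<^sup>2 + z\<^sup>2)) * qj"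
    proof -
      have 1: "x * x = N * N - y * y - z * z" using N2 by simp
      have "qcnj ?p * c * ?p = Quat 0 (x * (x*x + y*y + z*z - N * N))
          (y * (x*x+y*y+z*z) + 2 * N * (x*x+y*y+z*z) + y * (N * N)) (z * (x*x + y*y + z*z - N*N))"
        by (simp add: c qcnj_def times_quat_def) (simp add: algebra_simps)
      also have "\<dots> = quat_of_real (N * (x\<^sup>2 + (y + N)\<^sup>2 + z\<^sup>2)) * qj"
        unfolding qj_def quat_of_real_def times_quat_def power2_eq_square
        using N2[symmetric] by (simp add: algebra_simps)
          (simp add: 1 algebra_simps)
      finally show ?thesis .
    qed
    moreover have "x\<^sup>2 + (y + N)\<^sup>2 + z\<^sup>2 > 0"
      using yN by (metis add_nonneg_pos add_pos_nonneg zero_le_power2 zero_less_power2 add_nonneg_nonneg)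
    ultimately show ?thesis using N that by (meson mult_pos_pos)
  qed
  define r where "r = 1 / sqrt s"
  have rr: "r * r * s = 1" using p(2) by (simp add: r_def)
  have "qcnj (p * quat_of_real r) * c * (p * quat_of_real r)
      = quat_of_real r * (qcnj p * c * p) * quat_of_real r"
    by (simp add: mult.assoc)
  also have "\<dots> = quat_of_real (r * r * s) * qj"
    unfolding p(1) by (simp add: quat_of_real_def times_quat_def qj_def)
  finally have "qcnj (p * quat_of_real r) * c * (p * quat_of_real r) = qj" using rr by simp
  thus ?thesis by (rule that)
qed

text \<open>A nonzero diagonal entry is the value at a basis vector. If the diagonal vanishes and
  \<open>g\<close> is a nonzero entry at \<open>(k, l)\<close>, the vector
  \<open>e_k + e_l q\<close> has the value \<open>g q\<close> minus its conjugate, which is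
  \<open>2 i\<close> for \<open>q = g^-1 i\<close>.\<close>

lemma skew_hermitian_anisotropic_vector:
  assumes G: "G \<in> carrier_mat t t" and skew: "conj_transpose G = - G" and nz: "G \<noteq> 0\<^sub>m t t"
  obtains x where "x \<in> carrier_mat t 1" "(conj_transpose x * (G * x)) $$ (0, 0) \<noteq> 0"
proof -
  have G_skew: "qcnj (G $$ (j, i)) = - G $$ (i, j)" if "i < t" "j < t" for i j
    using arg_cong[OF skew, of "\<lambda>A. A $$ (i, j)"] that G by simp
  have form: "(conj_transpose x * (G * x)) $$ (0, 0)
      = (\<Sum>i<t. \<Sum>j<t. qcnj (x $$ (i, 0)) * G $$ (i, j) * x $$ (j, 0))"
    if x: "x \<in> carrier_mat t 1" for x
  proof -
    have "conj_transpose x \<in> carrier_mat 1 t" "G * x \<in> carrier_mat t 1" using x G by auto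
    from mat_mult_index[OF this] mat_mult_index[OF G x] x show ?thesis
      by (auto simp: sum_distrib_left mult.assoc simp del: index_mult_mat(1) intro!: sum.cong)
  qed
  show ?thesis
  proof (cases "\<exists>i<t. G $$ (i, i) \<noteq> 0")
    case True
    then obtain k where k: "k < t" "G $$ (k, k) \<noteq> 0" by blast
    let ?x = "mat t 1 (\<lambda>(i, _). if i = k then 1 else 0) :: quat mat"
    have "(conj_transpose ?x * (G * ?x)) $$ (0, 0)
        = (\<Sum>i<t. \<Sum>j<t. if j = k then if i = k then G $$ (i, k) else 0 else 0)"
      by (subst form, simp, intro sum.cong refl) auto
    also have "\<dots> = (\<Sum>i<t. if i = k then G $$ (k, k) else 0)"
      using k by (intro sum.cong) auto
    also have "\<dots> = G $$ (k, k)" using k by simp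
    finally show ?thesis using k that[of ?x] by simp
  next
    case False
    hence diag: "G $$ (i, i) = 0" if "i < t" for i using that by blast
    obtain k l where kl: "k < t" "l < t" "G $$ (k, l) \<noteq> 0"
      using nz G by (metis carrier_matD eq_matI index_zero_mat)
    hence neq: "k \<noteq> l" using diag by auto
    define g where "g = G $$ (k, l)"
    define q where "q = inverse g * qi"
    have g: "g \<noteq> 0" "G $$ (l, k) = - qcnj g" using kl G_skew[of l k] by (auto simp: g_def)
    have gq: "g * q = qi" using g by (simp add: q_def mult.assoc[symmetric])
    let ?x = "mat t 1 (\<lambda>(i, _). if i = k then 1 else if i = l then q else 0) :: quat mat"
    have "(conj_transpose ?x * (G * ?x)) $$ (0, 0)
        = (\<Sum>i<t. \<Sum>j<t. (if j = l then if i = k then g * q else 0 else 0)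
            + (if j = k then if i = l then - (qcnj q * qcnj g) else 0 else 0))"
      using neq by (subst form) (auto intro!: sum.cong simp: diag kl g g_def[symmetric])
    also have "\<dots> = g * q - qcnj (g * q)" using kl by (simp add: sum.distrib)
    also have "\<dots> = qi + qi" by (simp add: gq)
    finally show ?thesis using that[of ?x] quat_double_eq_0[of qi] by auto
  qed
qed

definition qj_mat :: "nat \<Rightarrow> quat mat" where
  "qj_mat k = qj \<cdot>\<^sub>m 1\<^sub>m k"

lemma qj_mat_carrier [simp]: "qj_mat k \<in> carrier_mat k k"
  and dim_qj_mat [simp]: "dim_row (qj_mat k) = k" "dim_col (qj_mat k) = k"
  by (simp_all add: qj_mat_def carrier_matI)

lemma qj_mat_index: "i < k \<Longrightarrow> j < k \<Longrightarrow> qj_mat k $$ (i, j) = (if i = j then qj else 0)"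
  by (simp add: qj_mat_def)

lemma qj_mat_sq: "qj_mat k * qj_mat k = - 1\<^sub>m k"
proof (rule eq_matI)
  fix i j assume ij: "i < dim_row (- 1\<^sub>m k :: quat mat)" "j < dim_col (- 1\<^sub>m k :: quat mat)"
  have "(qj_mat k * qj_mat k) $$ (i, j) = (\<Sum>l<k. qj_mat k $$ (i, l) * qj_mat k $$ (l, j))"
    using ij by (intro mat_mult_index) auto
  also have "\<dots> = (\<Sum>l<k. if l = i then if i = j then - 1 else 0 else 0)"
    using ij by (intro sum.cong) (auto simp: qj_mat_index qj_qj)
  also have "\<dots> = (- 1\<^sub>m k :: quat mat) $$ (i, j)" using ij by simp
  finally show "(qj_mat k * qj_mat k) $$ (i, j) = (- 1\<^sub>m k) $$ (i, j)" .
qed auto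

lemma conj_transpose_qj_mat: "conj_transpose (qj_mat k) = - qj_mat k"
  by (rule eq_matI) (auto simp: qj_mat_index)

text \<open>Gram-Schmidt: the form does not vanish on the orthogonal complement of the columns found
  so far, so the complement contains an anisotropic vector, which can be scaled to the value
  \<open>j\<close>. The left inverse \<open>N\<close> encodes nondegeneracy.\<close>

lemma skew_hermitian_system:
  assumes M: "M \<in> carrier_mat t t" and skew: "conj_transpose M = - M"
    and N: "N \<in> carrier_mat t t" and NM: "N * M = 1\<^sub>m t" and "k \<le> t"
  shows "\<exists>V \<in> carrier_mat t k. conj_transpose V * (M * V) = qj_mat k"
  using \<open>k \<le> t\<close>
proof (induction k)
  case 0
  show ?case
    by (rule bexI[of _ "0\<^sub>m t 0"]) (auto intro!: eq_matI)
next
  case (Suc k)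
  then obtain V where V: "V \<in> carrier_mat t k" and VMV: "conj_transpose V * (M * V) = qj_mat k"
    by auto
  have k: "k < t" using Suc by simp
  let ?V = "conj_transpose V" let ?D = "qj_mat k"
  have V': "?V \<in> carrier_mat k t" and D: "?D \<in> carrier_mat k k" using V by auto
  note [simp] = carrier_matD[OF V] carrier_matD[OF M] carrier_matD[OF N]
  have MV: "M * V \<in> carrier_mat t k" and VM: "?V * M \<in> carrier_mat k t" using M V by auto
  \<comment> \<open>Since \<open>?D\<close> squares to \<open>- 1\<close>, this is a left inverse of
    \<open>V\<close>, and \<open>V * W\<close> is the orthogonal projection for \<open>M\<close>
    onto the span of \<open>V\<close>. Below, \<open>F\<close> projects onto the complement.\<close>
  define W where "W = - (?D * (?V * M))"
  have dW [simp]: "dim_row W = k" "dim_col W = t" by (simp_all add: W_def)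
  have W: "W \<in> carrier_mat k t" by (rule carrier_matI) simp_all
  have "W * V = - (?D * (?V * (M * V)))" by (simp add: W_def mat_assoc)
  hence WV: "W * V = 1\<^sub>m k" by (simp add: VMV qj_mat_sq)
  define F where "F = 1\<^sub>m t + (- (V * W))"
  have dF [simp]: "dim_row F = t" "dim_col F = t" by (simp_all add: F_def)
  have F: "F \<in> carrier_mat t t" by (rule carrier_matI) simp_all
  have VW: "V * W \<in> carrier_mat t t" using V W by simp
  \<comment> \<open>The trace replaces a dimension count: the complement has dimension
    \<open>t - k > 0\<close>.\<close>
  have "real_trace F = real t - real k"
    using real_trace_commute[OF V W] VW WV
    by (simp add: F_def real_trace_add[of _ t] real_trace_uminus[of _ t])
  hence F0: "F \<noteq> 0\<^sub>m t t" using k by (auto simp: real_trace_def)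
  have "V * W * (V * W) = V * (W * V * W)" by (simp add: mat_assoc)
  hence VWVW: "V * W * (V * W) = V * W" using WV by simp
  have FF: "F * F = F"
  proof -
    have "F * (V * W) = 0\<^sub>m t t"
      by (simp add: F_def mat_distrib_right VWVW mat_add_uminus left_mult_one_mat')
    hence "F * F = F + - 0\<^sub>m t t"
      by (subst (2) F_def) (simp add: mat_distrib_left right_mult_one_mat')
    thus ?thesis by (auto intro!: eq_matI)
  qed
  \<comment> \<open>The form restricted to the complement: \<open>F\<close> is self-adjoint for
    \<open>M\<close>, so \<open>M * F\<close> is also the compression of \<open>M\<close> by
    \<open>F\<close> from both sides. It is nonzero because \<open>M\<close> is invertible.\<close>
  define G where "G = M * F"
  have dG [simp]: "dim_row G = t" "dim_col G = t" by (simp_all add: G_def)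
  have G: "G \<in> carrier_mat t t" by (rule carrier_matI) simp_all
  have "G \<noteq> 0\<^sub>m t t"
  proof
    assume "G = 0\<^sub>m t t"
    hence "N * G = 0\<^sub>m t t" by simp
    moreover have "N * G = N * M * F" by (simp add: G_def mat_assoc)
    ultimately show False using F0 NM by (simp add: left_mult_one_mat')
  qed
  have G_expand: "G = M + M * V * (?D * (?V * M))"
    by (simp add: G_def F_def W_def mat_distrib_left right_mult_one_mat' mat_assoc)
  have skewG: "conj_transpose G = - G"
    by (simp add: G_expand mat_algebra skew conj_transpose_qj_mat)
  obtain x where x: "x \<in> carrier_mat t 1" and "(conj_transpose x * (G * x)) $$ (0, 0) \<noteq> 0"
    using skew_hermitian_anisotropic_vector[OF G skewG \<open>G \<noteq> 0\<^sub>m t t\<close>] by blast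
  define c where "c = (conj_transpose x * (G * x)) $$ (0, 0)"
  have c0: "c \<noteq> 0" using \<open>_ \<noteq> 0\<close> by (simp add: c_def)
  have dx [simp]: "dim_row x = t" "dim_col x = 1" using x by auto
  have "conj_transpose (conj_transpose x * (G * x)) = - (conj_transpose x * (G * x))"
    by (simp add: mat_algebra skewG)
  from arg_cong[OF this, of "\<lambda>A. A $$ (0, 0)"] have "qcnj c = - c"
    by (simp add: c_def del: index_mult_mat(1))
  then obtain q where q: "qcnj q * c * q = qj" using imaginary_quat_congruent_qj c0 by blast
  \<comment> \<open>Vectors are scaled from the right; a matrix of size \<open>1\<close> keeps this
    within matrix multiplication.\<close>
  define Q where "Q = mat 1 1 (\<lambda>_. q)"
  have dQ [simp]: "dim_row Q = 1" "dim_col Q = 1" by (simp_all add: Q_def)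
  define v where "v = F * (x * Q)"
  have dv [simp]: "dim_row v = t" "dim_col v = 1" by (simp_all add: v_def)
  have v: "v \<in> carrier_mat t 1" by (rule carrier_matI) simp_all
  have VG: "?V * G = 0\<^sub>m k t"
  proof -
    have "?V * G = ?V * M + ?V * (M * V) * (?D * (?V * M))"
      unfolding G_expand by (simp add: mat_distrib_left mat_assoc)
    also have "?V * (M * V) * (?D * (?V * M)) = ?D * ?D * (?V * M)"
      unfolding VMV by (simp add: mat_assoc)
    also have "\<dots> = - (?V * M)" by (simp add: qj_mat_sq)
    finally show ?thesis by (simp add: mat_add_uminus)
  qed
  have Mv: "M * v = G * (x * Q)" by (simp add: v_def G_def mat_assoc)
  have VMv: "?V * (M * v) = 0\<^sub>m k 1"
  proof -
    have "?V * (M * v) = ?V * G * (x * Q)" unfolding Mv by (simp add: mat_assoc)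
    thus ?thesis by (simp add: VG)
  qed
  have vMV: "conj_transpose v * (M * V) = 0\<^sub>m 1 k"
  proof -
    have "conj_transpose v * (M * V) = - conj_transpose (?V * (M * v))"
      by (simp add: mat_conj_transpose_mult skew mat_assoc)
    thus ?thesis unfolding VMv by (auto intro!: eq_matI)
  qed
  have vMv: "(conj_transpose v * (M * v)) $$ (0, 0) = qj"
  proof -
    have "conj_transpose F * M = conj_transpose (- (M * F))"
      by (simp add: mat_conj_transpose_mult skew)
    also have "\<dots> = G" using skewG by (simp add: G_def)
    finally have FM: "conj_transpose F * M = G" .
    have "conj_transpose F * G = conj_transpose F * M * F" by (simp add: G_def mat_assoc)
    also have "\<dots> = M * (F * F)" by (simp add: FM) (simp add: G_def mat_assoc)
    finally have FG: "conj_transpose F * G = G" by (simp add: FF G_def)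
    have "conj_transpose v * (M * v) = conj_transpose Q * (conj_transpose x * (conj_transpose F * G * (x * Q)))"
      unfolding Mv by (simp add: v_def mat_conj_transpose_mult mat_assoc)
    also have "\<dots> = conj_transpose Q * (conj_transpose x * (G * x)) * Q"
      unfolding FG by (simp add: mat_assoc)
    also have "\<dots> $$ (0, 0) = (conj_transpose Q * (conj_transpose x * (G * x))) $$ (0, 0) * q"
      by (subst mat_mult_index[of _ 1 1 _ 1]) (auto intro: carrier_matI simp: Q_def)
    also have "(conj_transpose Q * (conj_transpose x * (G * x))) $$ (0, 0) = qcnj q * c"
      by (subst mat_mult_index[of _ 1 1 _ 1]) (auto intro: carrier_matI simp: Q_def c_def)
    finally show ?thesis using q by simp
  qed
  define V1 where "V1 = mat t (Suc k) (\<lambda>(i, a). if a < k then V $$ (i, a) else v $$ (i, 0))"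
  have V1: "V1 \<in> carrier_mat t (Suc k)" by (simp add: V1_def)
  have sandwich: "(conj_transpose A * (M * B)) $$ (a, b)
      = (\<Sum>i<t. qcnj (A $$ (i, a)) * (\<Sum>j<t. M $$ (i, j) * B $$ (j, b)))"
    if A: "A \<in> carrier_mat t m" and B: "B \<in> carrier_mat t l" and ab: "a < m" "b < l" for A B m l a b
  proof -
    have "conj_transpose A \<in> carrier_mat m t" "M * B \<in> carrier_mat t l" using A M B by auto
    from mat_mult_index[OF this ab] mat_mult_index[OF M B] A ab show ?thesis
      by (auto simp del: index_mult_mat(1) intro!: sum.cong)
  qed
  have "conj_transpose V1 * (M * V1) = qj_mat (Suc k)"
  proof (rule eq_matI)
    fix a b assume "a < dim_row (qj_mat (Suc k))" "b < dim_col (qj_mat (Suc k))"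
    hence ab: "a < Suc k" "b < Suc k" by auto
    \<comment> \<open>Old and new columns are treated alike: column \<open>a\<close> of
      \<open>V1\<close> is column \<open>?a a\<close> of \<open>?X a\<close>.\<close>
    let ?X = "\<lambda>a. if a < k then V else v" and ?n = "\<lambda>a. if a < k then k else 1"
      and ?a = "\<lambda>a. if a < k then a else 0"
    have X: "?X a \<in> carrier_mat t (?n a)" for a using V v by simp
    have V1_X: "V1 $$ (i, a) = ?X a $$ (i, ?a a)" if "i < t" "a < Suc k" for i a
      using that by (simp add: V1_def)
    have "(conj_transpose V1 * (M * V1)) $$ (a, b) = (conj_transpose (?X a) * (M * ?X b)) $$ (?a a, ?a b)"
      using ab by (subst sandwich[OF V1 V1 ab], subst sandwich[OF X X]) (auto simp: V1_X)
    also have "\<dots> = qj_mat (Suc k) $$ (a, b)"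
      using ab VMV VMv vMV vMv by (auto simp: qj_mat_index simp del: index_mult_mat(1))
    finally show "(conj_transpose V1 * (M * V1)) $$ (a, b) = qj_mat (Suc k) $$ (a, b)" .
  qed (use V1 in auto)
  thus ?case using V1 by blast
qed

text \<open>A direct sum of blocks with rows \<open>(0, - i)\<close> and \<open>(i, 0)\<close>,
  pairing the indices \<open>2 m\<close> and \<open>2 m + 1\<close>. For odd \<open>t\<close> the
  last row would be zero.\<close>

definition swap_mat :: "nat \<Rightarrow> quat mat" where
  "swap_mat t = mat t t (\<lambda>(a, b). if even a \<and> b = Suc a then - qi else if odd a \<and> a = Suc b then qi else 0)"

text \<open>Row \<open>a\<close> has a single nonzero entry, \<open>i\<close> or \<open>- i\<close>,
  at the partner \<open>p a\<close>. Anticommutation with \<open>j\<close> therefore holds entry by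
  entry.\<close>

lemma swap_mat:
  assumes "even t"
  shows "swap_mat t \<in> carrier_mat t t" "swap_mat t * swap_mat t = 1\<^sub>m t"
    "conj_transpose (swap_mat t) = swap_mat t" "swap_mat t * qj_mat t = - (qj_mat t * swap_mat t)"
proof -
  let ?S = "swap_mat t"
  show S: "?S \<in> carrier_mat t t" by (simp add: swap_mat_def)
  define p where "p = (\<lambda>a :: nat. if even a then Suc a else a - 1)"
  define s where "s = (\<lambda>a :: nat. if even a then - qi else qi)"
  have p_less: "p a < t" if "a < t" for a
    using that assms by (auto simp: p_def) (metis Suc_lessI even_Suc)
  have idx: "?S $$ (a, b) = (if b = p a then s a else 0)" if "a < t" "b < t" for a b
    using that by (auto simp: swap_mat_def p_def s_def elim: oddE)
  have pp: "p (p a) = a" for a by (auto simp: p_def elim: oddE)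
  have ss: "s a * s (p a) = 1" for a by (auto simp: p_def s_def qi_qi elim: oddE)
  show "?S * ?S = 1\<^sub>m t"
  proof (rule eq_matI)
    fix a b assume "a < dim_row (1\<^sub>m t)" "b < dim_col (1\<^sub>m t)"
    hence ab: "a < t" "b < t" by auto
    have "(?S * ?S) $$ (a, b) = (\<Sum>l<t. if l = p a then s a * ?S $$ (l, b) else 0)"
      by (subst mat_mult_index[OF S S ab], rule sum.cong[OF refl]) (use ab in \<open>auto simp: idx\<close>)
    also have "\<dots> = 1\<^sub>m t $$ (a, b)" using ab p_less[of a] by (auto simp: idx pp ss)
    finally show "(?S * ?S) $$ (a, b) = 1\<^sub>m t $$ (a, b)" .
  qed (use S in auto)
  show "conj_transpose ?S = ?S"
    by (rule eq_matI) (auto simp: swap_mat_def)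
  show "?S * qj_mat t = - (qj_mat t * ?S)"
  proof (rule eq_matI)
    fix a b assume "a < dim_row (- (qj_mat t * ?S))" "b < dim_col (- (qj_mat t * ?S))"
    hence ab: "a < t" "b < t" using S by auto
    have "(?S * qj_mat t) $$ (a, b) = (\<Sum>l<t. if l = b then ?S $$ (a, l) * qj else 0)"
      by (subst mat_mult_index[OF S qj_mat_carrier ab], rule sum.cong[OF refl])
        (use ab in \<open>auto simp: qj_mat_index\<close>)
    moreover have "(qj_mat t * ?S) $$ (a, b) = (\<Sum>l<t. if l = a then qj * ?S $$ (l, b) else 0)"
      by (subst mat_mult_index[OF qj_mat_carrier S ab], rule sum.cong[OF refl])
        (use ab in \<open>auto simp: qj_mat_index\<close>)
    moreover have "?S $$ (a, b) * qj = - (qj * ?S $$ (a, b))"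
      using ab by (simp add: idx s_def qj_qi)
    ultimately show "(?S * qj_mat t) $$ (a, b) = (- (qj_mat t * ?S)) $$ (a, b)"
      using ab S by (simp del: index_mult_mat(1))
  qed (use S in auto)
qed

text \<open>In a basis \<open>V\<close> that normalises the form to \<open>j I\<close>, the
  Hermitian involution \<open>swap_mat t\<close> anticommutes with the form; conjugating it by
  \<open>V\<close> gives \<open>S\<close>.\<close>

lemma skew_hermitian_negating_involution:
  assumes M: "M \<in> carrier_mat t t" and skew: "conj_transpose M = - M"
    and N: "N \<in> carrier_mat t t" and NM: "N * M = 1\<^sub>m t" and t: "even t"
  obtains S where "S \<in> carrier_mat t t" "S * S = 1\<^sub>m t" "conj_transpose S * M = - (M * S)"
proof -
  obtain V where V: "V \<in> carrier_mat t t" and VMV: "conj_transpose V * (M * V) = qj_mat t"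
    using skew_hermitian_system[OF M skew N NM order.refl] by blast
  note R = swap_mat[OF t]
  let ?V = "conj_transpose V" and ?D = "qj_mat t" and ?R = "swap_mat t"
  note [simp] = carrier_matD[OF V] carrier_matD[OF M] carrier_matD[OF R(1)]
  define W where "W = - (?D * (?V * M))"
  have dW [simp]: "dim_row W = t" "dim_col W = t" by (simp_all add: W_def)
  have W: "W \<in> carrier_mat t t" by (rule carrier_matI) simp_all
  have "W * V = - (?D * (?V * (M * V)))" by (simp add: W_def mat_assoc)
  hence WV: "W * V = 1\<^sub>m t" by (simp add: VMV qj_mat_sq)
  hence VW: "V * W = 1\<^sub>m t" by (rule quat_mat_left_right_inverse[OF W V])
  have VM: "?V * M = ?D * W"
  proof -
    have "?D * W = - (?D * ?D * (?V * M))" by (simp add: W_def mat_assoc)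
    thus ?thesis by (simp add: qj_mat_sq)
  qed
  have MV: "M * V = conj_transpose W * ?D"
  proof -
    have "conj_transpose (?V * M) = - (M * V)"
      by (simp add: mat_conj_transpose_mult skew)
    moreover have "conj_transpose (?D * W) = - (conj_transpose W * ?D)"
      by (simp add: mat_conj_transpose_mult conj_transpose_qj_mat)
    ultimately show ?thesis using VM by (metis uminus_uminus_mat)
  qed
  define S where "S = V * (?R * W)"
  have dS [simp]: "dim_row S = t" "dim_col S = t" by (simp_all add: S_def)
  have S: "S \<in> carrier_mat t t" by (rule carrier_matI) simp_all
  have "S * S = V * (?R * (W * V * (?R * W)))" by (simp add: S_def mat_assoc)
  also have "\<dots> = V * (?R * ?R * W)" by (simp add: WV mat_assoc)
  finally have "S * S = 1\<^sub>m t" by (simp add: R(2) VW)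
  moreover have "conj_transpose S * M = - (M * S)"
  proof -
    have "conj_transpose S * M = conj_transpose W * (?R * (?V * M))"
      by (simp add: S_def mat_conj_transpose_mult mat_assoc R(3))
    also have "\<dots> = conj_transpose W * (?R * ?D * W)" unfolding VM by (simp add: mat_assoc)
    also have "\<dots> = - (conj_transpose W * ?D * (?R * W))"
      unfolding R(4) by (simp add: mat_assoc)
    also have "\<dots> = - (M * S)"
      unfolding MV[symmetric] by (simp add: S_def mat_assoc)
    finally show ?thesis .
  qed
  ultimately show ?thesis using S that by blast
qed

section \<open>The matrix sign function on a graded space\<close>

section \<open>Newton iteration towards a self-adjoint involution\<close>

text \<open>With basis vectors graded by \<open>w\<close>, a matrix of gap \<open>g\<close> lowers
  the weight by at least \<open>g\<close>. Gaps add under products, and a gap beyond the range of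
  \<open>w\<close> forces the zero matrix.\<close>

definition mat_gap :: "(nat \<Rightarrow> nat) \<Rightarrow> nat \<Rightarrow> quat mat \<Rightarrow> bool" where
  "mat_gap w g A \<longleftrightarrow> (\<forall>i<dim_row A. \<forall>j<dim_col A. A $$ (i, j) \<noteq> 0 \<longrightarrow> w i + g \<le> w j)"

lemma mat_gap_mult:
  assumes "mat_gap w g A" "mat_gap w h B" "dim_col A = dim_row B"
  shows "mat_gap w (g + h) (A * B)"
  unfolding mat_gap_def
proof (intro allI impI)
  fix i j assume i: "i < dim_row (A * B)" and j: "j < dim_col (A * B)" and nz: "(A * B) $$ (i, j) \<noteq> 0"
  have "(A * B) $$ (i, j) = (\<Sum>l<dim_col A. A $$ (i, l) * B $$ (l, j))"
    using i j assms(3) by (intro mat_mult_index[of _ "dim_row A" _ _ "dim_col B"]) auto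
  with nz obtain l where "l < dim_col A" "A $$ (i, l) * B $$ (l, j) \<noteq> 0"
    by (metis (no_types, lifting) lessThan_iff sum.neutral)
  with assms i j have "w i + g \<le> w l" "w l + h \<le> w j"
    unfolding mat_gap_def by auto
  thus "w i + (g + h) \<le> w j" by simp
qed

lemma mat_gap_add:
  "mat_gap w g A \<Longrightarrow> mat_gap w g B \<Longrightarrow> dim_row A = dim_row B \<Longrightarrow> dim_col A = dim_col B \<Longrightarrow>
   mat_gap w g (A + B)"
  unfolding mat_gap_def by (metis add_0 index_add_mat)

lemma mat_gap_uminus: "mat_gap w g A \<Longrightarrow> mat_gap w g (- A)"
  unfolding mat_gap_def by simp

lemma mat_gap_rscale: "mat_gap w g A \<Longrightarrow> mat_gap w g (rscale r A)"
  unfolding mat_gap_def by simp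

lemma mat_gap_mono: "mat_gap w g A \<Longrightarrow> h \<le> g \<Longrightarrow> mat_gap w h A"
  unfolding mat_gap_def by force

lemma mat_rscale_mult:
  "dim_col A = dim_row B \<Longrightarrow> rscale r A * B = rscale r (A * B)"
  "dim_col A = dim_row B \<Longrightarrow> A * rscale r B = rscale r (A * B)"
  by (rule rscale_mult_left[of A "dim_row A" "dim_col A" _ "dim_col B"]; auto intro: carrier_matI)
     (rule rscale_mult_right[of A "dim_row A" "dim_col A" _ "dim_col B"]; auto intro: carrier_matI)

lemma mat_rscale_add:
  "dim_row A = dim_row B \<Longrightarrow> dim_col A = dim_col B \<Longrightarrow> rscale r (A + B) = rscale r A + rscale r B"
  by (rule rscale_add[of A "dim_row A" "dim_col A"]) (auto intro: carrier_matI)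

text \<open>With \<open>a\<^sup>2 = 1 + 2 C\<close>, the Newton step \<open>a \<mapsto> a (3 - a\<^sup>2) / 2 = a (1 - C)\<close> for the matrix sign
  function replaces \<open>C\<close> by \<open>C\<^sup>3 - 3/2 C\<^sup>2\<close>, which doubles the gap. It preserves self-adjointness
  for \<open>H\<close> and anticommutation with \<open>J\<close>.\<close>

lemma self_adjoint_sign:
  fixes w :: "nat \<Rightarrow> nat"
  assumes dims: "H \<in> carrier_mat n n" "J \<in> carrier_mat n n" and w: "\<And>i. i < n \<Longrightarrow> w i < b"
    and "a \<in> carrier_mat n n" "C \<in> carrier_mat n n" "mat_gap w g C" "g > 0"
    and "a * a = 1\<^sub>m n + (C + C)" "a * C = C * a"
    and "conj_transpose a * H = H * a" "a * J = - (J * a)"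
    and "conj_transpose C * H = H * C" "C * J = J * C"
  shows "\<exists>T \<in> carrier_mat n n. T * T = 1\<^sub>m n \<and> conj_transpose T * H = H * T \<and> T * J = - (J * T)"
  using assms(4-)
proof (induction "b - g" arbitrary: a C g rule: less_induct)
  case less
  note a = less.prems(1) and C = less.prems(2) and gap = less.prems(3) and g = less.prems(4)
    and aa = less.prems(5) and aC = less.prems(6) and aH = less.prems(7) and aJ = less.prems(8)
    and CH = less.prems(9) and CJ = less.prems(10)
  show ?case
  proof (cases "b \<le> g")
    case True
    \<comment> \<open>All weights lie below \<open>b\<close>, so a gap of at least \<open>b\<close>
      leaves no room for a nonzero entry, and \<open>a\<close> is an exact involution.\<close>
    have "C = 0\<^sub>m n n"
    proof (rule eq_matI)
      fix i j assume "i < dim_row (0\<^sub>m n n :: quat mat)" "j < dim_col (0\<^sub>m n n :: quat mat)"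
      hence ij: "i < n" "j < n" by auto
      with w[of j] True have "\<not> w i + g \<le> w j" by simp
      with gap ij C show "C $$ (i, j) = 0\<^sub>m n n $$ (i, j)" by (auto simp: mat_gap_def)
    qed (use C in auto)
    hence "a * a = 1\<^sub>m n" using aa by simp
    with a aH aJ show ?thesis by blast
  next
    case False
    note [simp] = carrier_matD[OF a] carrier_matD[OF C] carrier_matD[OF dims(1)] carrier_matD[OF dims(2)]
    have aC': "a * (C * X) = C * (a * X)" if "dim_row X = n" for X
      using that aC by (simp flip: mat_assoc)
    have CJ': "C * (J * X) = J * (C * X)" if "dim_row X = n" for X
      using that CJ by (simp flip: mat_assoc)
    have CH': "conj_transpose C * (H * X) = H * (C * X)" if "dim_row X = n" for X
      using that CH by (simp flip: mat_assoc)
    have aH': "conj_transpose a * (H * X) = H * (a * X)" if "dim_row X = n" for X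
      using that aH by (simp flip: mat_assoc)
    have aJ': "a * (J * X) = - (J * (a * X))" if "dim_row X = n" for X
    proof -
      have "a * (J * X) = a * J * X" using that by (simp add: mat_assoc)
      also have "\<dots> = - (J * (a * X))" unfolding aJ using that by (simp add: mat_assoc)
      finally show ?thesis .
    qed
    \<comment> \<open>The new error comes from
      \<open>(1 + 2 C) (1 - C)^2 = 1 + 2 (C^3 - 3/2 C^2)\<close>, where \<open>a * C = C * a\<close>
      lets all factors commute.\<close>
    let ?a = "a + - (a * C)" and ?h = "rscale (1/2) (C * C)"
    let ?C = "C * (C * C) + (- (C * C) + - ?h)"
    have h: "?h + ?h = C * C" by (rule rscale_half_double)
    have "?a * ?a = 1\<^sub>m n + (?C + ?C)"
    proof -
      have "?a * ?a = 1\<^sub>m n + (C + C) + (- (C + (C * C + C * C)) + (- (C + (C * C + C * C)) + (C * C + (C * (C * C) + C * (C * C)))))"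
        by (simp add: mat_distrib_left mat_distrib_right mat_assoc aC aC' aa)
          (rule eq_matI; simp del: index_mult_mat(1))
      also have "\<dots> = 1\<^sub>m n + (?C + ?C)"
      proof (rule eq_matI)
        fix i j assume "i < dim_row (1\<^sub>m n + (?C + ?C))" "j < dim_col (1\<^sub>m n + (?C + ?C))"
        hence ij: "i < n" "j < n" by auto
        \<comment> \<open>Writing an entry of \<open>C * C\<close> as \<open>x + x\<close> absorbs
          the coefficient \<open>3/2\<close>, so the identity becomes purely additive.\<close>
        define x where "x = ?h $$ (i, j)"
        have hij: "(C * C) $$ (i, j) = x + x"
          using arg_cong[OF h, of "\<lambda>A. A $$ (i, j)"] ij
          by (simp add: x_def del: index_mult_mat(1) rscale_index)
        show "(1\<^sub>m n + (C + C) + (- (C + (C * C + C * C)) + (- (C + (C * C + C * C)) + (C * C + (C * (C * C) + C * (C * C)))))) $$ (i, j)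
            = (1\<^sub>m n + (?C + ?C)) $$ (i, j)"
          using ij by (simp add: hij x_def[symmetric] del: index_mult_mat(1) rscale_index)
      qed auto
      finally show ?thesis .
    qed
    moreover have "?a * ?C = ?C * ?a"
      by (simp add: mat_distrib_left mat_distrib_right mat_assoc mat_rscale_mult mat_rscale_add mat_uminus_add
          aC aC' rscale_uminus)
        (rule eq_matI; simp del: index_mult_mat(1))
    moreover have "conj_transpose ?a * H = H * ?a"
      by (simp add: mat_distrib_left mat_distrib_right mat_assoc mat_conj_transpose_mult mat_conj_transpose_add aH aH' CH CH' aC)
    moreover have "?a * J = - (J * ?a)"
      by (simp add: mat_distrib_left mat_distrib_right mat_assoc mat_uminus_add aJ aJ' CJ)
    moreover have "conj_transpose ?C * H = H * ?C"
      by (simp add: mat_distrib_left mat_distrib_right mat_assoc mat_conj_transpose_mult mat_conj_transpose_add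
          conj_transpose_rscale mat_rscale_mult CH CH')
    moreover have "?C * J = J * ?C"
      by (simp add: mat_distrib_left mat_distrib_right mat_assoc mat_rscale_mult CJ CJ')
    moreover have "mat_gap w (g + g) ?C"
      using mat_gap_mult[OF gap gap] mat_gap_mult[OF gap mat_gap_mult[OF gap gap]]
      by (intro mat_gap_add mat_gap_uminus mat_gap_rscale) (auto elim: mat_gap_mono)
    moreover have "b - (g + g) < b - g" using False g by simp
    moreover have "?a \<in> carrier_mat n n" "?C \<in> carrier_mat n n" by (auto intro: carrier_matI)
    ultimately show ?thesis using g less.hyps[of "g + g" ?a ?C] by simp
  qed
qed

section \<open>Block coordinates, and zero patterns forced by the Jordan matrix\<close>

section \<open>Coordinates in a nilpotent Jordan basis\<close>

text \<open>The triple \<open>(d, i, l)\<close> stands for the basis vector in position \<open>l\<close> of the \<open>i\<close>-th Jordan block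
  of size \<open>d\<close>.\<close>

definition jordan_index :: "nat multiset \<Rightarrow> (nat \<times> nat \<times> nat) set" where
  "jordan_index N = {(d, i, l). i < count N d \<and> l < d}"

text \<open>The matrix orders blocks by the list, the triples group them by size. A block put in
  front gets the next free number \<open>count N c\<close> among those of its size, and all older
  positions shift by \<open>c\<close>.\<close>

lemma jordan_matrix_index:
  "\<exists>ix. bij_betw ix (jordan_index (mset ds)) {..<sum_list ds} \<and>
    (\<forall>(d, i, l) \<in> jordan_index (mset ds). \<forall>(e, j, m) \<in> jordan_index (mset ds).
      jordan_matrix (map (\<lambda>d. (d, 0 :: 'a :: ring_1)) ds) $$ (ix (d, i, l), ix (e, j, m))
        = (if d = e \<and> i = j \<and> m = Suc l then 1 else 0))"
proof (induction ds)
  case Nil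
  show ?case by (auto simp: jordan_index_def bij_betw_def inj_on_def intro!: exI[of _ "\<lambda>_. 0"])
next
  case (Cons c ds)
  let ?N = "mset ds" and ?jm = "\<lambda>ds. jordan_matrix (map (\<lambda>d. (d, 0 :: 'a)) ds)"
  obtain ix where ix: "bij_betw ix (jordan_index ?N) {..<sum_list ds}"
    and J: "\<And>d i l e j m. (d, i, l) \<in> jordan_index ?N \<Longrightarrow> (e, j, m) \<in> jordan_index ?N \<Longrightarrow>
      ?jm ds $$ (ix (d, i, l), ix (e, j, m)) = (if d = e \<and> i = j \<and> m = Suc l then 1 else 0)"
    using Cons.IH by fastforce
  define New where "New = (\<lambda>l. (c, count ?N c, l)) ` {..<c}"
  define ix' where "ix' = (\<lambda>(d, i, l). if d = c \<and> i = count ?N c then l else c + ix (d, i, l))"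
  have split: "jordan_index (mset (c # ds)) = jordan_index ?N \<union> New"
    by (auto simp: jordan_index_def New_def less_Suc_eq split: if_splits)
  have old: "ix' x = c + ix x" "ix x < sum_list ds" if "x \<in> jordan_index ?N" for x
    using that bij_betwE[OF ix] by (auto simp: ix'_def jordan_index_def)
  have new: "ix' (c, count ?N c, l) = l" for l by (simp add: ix'_def)
  have "bij_betw ix' (jordan_index ?N) {c..<c + sum_list ds}"
  proof -
    have "bij_betw (\<lambda>x. c + x) {..<sum_list ds} {c..<c + sum_list ds}"
      by (rule bij_betw_byWitness[where f' = "\<lambda>x. x - c"]) auto
    from bij_betw_trans[OF ix this] show ?thesis
      by (rule iffD1[OF bij_betw_cong, rotated]) (simp add: old)
  qed
  moreover have "bij_betw ix' New {..<c}"
    by (rule bij_betw_byWitness[where f' = "\<lambda>l. (c, count ?N c, l)"]) (auto simp: New_def new)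
  ultimately have "bij_betw ix' (jordan_index ?N \<union> New) ({c..<c + sum_list ds} \<union> {..<c})"
    by (rule bij_betw_combine) auto
  moreover have "{c..<c + sum_list ds} \<union> {..<c} = {..<sum_list (c # ds)}" by auto
  ultimately have bij: "bij_betw ix' (jordan_index (mset (c # ds))) {..<sum_list (c # ds)}"
    by (simp only: split)
  have s: "sum_list (map fst (map (\<lambda>d. (d, 0 :: 'a)) ds)) = sum_list ds" by (simp add: o_def)
  have Jc: "?jm (c # ds) = four_block_mat (jordan_block c 0) (0\<^sub>m c (sum_list ds)) (0\<^sub>m (sum_list ds) c) (?jm ds)"
    using jordan_matrix_Cons[of c "0 :: 'a" "map (\<lambda>d. (d, 0)) ds"] s by simp
  have dim: "dim_row (?jm ds) = sum_list ds" "dim_col (?jm ds) = sum_list ds"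
    using s by simp_all
  show ?case
  proof (intro exI[of _ ix'] conjI bij, clarify)
    fix d i l e j m
    assume x: "(d, i, l) \<in> jordan_index (mset (c # ds))" and y: "(e, j, m) \<in> jordan_index (mset (c # ds))"
    show "?jm (c # ds) $$ (ix' (d, i, l), ix' (e, j, m)) = (if d = e \<and> i = j \<and> m = Suc l then 1 else 0)"
    proof (cases "(d, i, l) \<in> jordan_index ?N"; cases "(e, j, m) \<in> jordan_index ?N")
      assume 1: "(d, i, l) \<in> jordan_index ?N" "(e, j, m) \<in> jordan_index ?N"
      thus ?thesis unfolding Jc using old[OF 1(1)] old[OF 1(2)] J[OF 1] dim by simp
    next
      assume 1: "(d, i, l) \<in> jordan_index ?N" "(e, j, m) \<notin> jordan_index ?N"
      hence "e = c" "j = count ?N c" "m < c" using y split by (auto simp: New_def)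
      with 1 show ?thesis unfolding Jc using old[OF 1(1)] dim new by (auto simp: jordan_index_def)
    next
      assume 1: "(d, i, l) \<notin> jordan_index ?N" "(e, j, m) \<in> jordan_index ?N"
      hence "d = c" "i = count ?N c" "l < c" using x split by (auto simp: New_def)
      with 1 show ?thesis unfolding Jc using old[OF 1(2)] dim new by (auto simp: jordan_index_def)
    next
      assume 1: "(d, i, l) \<notin> jordan_index ?N" "(e, j, m) \<notin> jordan_index ?N"
      hence "d = c" "i = count ?N c" "l < c" "e = c" "j = count ?N c" "m < c"
        using x y split by (auto simp: New_def)
      thus ?thesis unfolding Jc using dim new by auto
    qed
  qed
qed

text \<open>\<open>H\<close> is the Gram matrix of the form in a Jordan basis, \<open>K\<close> its
  inverse, and the last assumption makes \<open>J\<close> skew-adjoint. As \<open>J\<close> carries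
  position \<open>Suc l\<close> to \<open>l\<close>, position \<open>0\<close> of a block lies in
  the kernel and position \<open>d - 1\<close> is the top vector generating the block.\<close>

locale hermitian_jordan =
  fixes N :: "nat multiset" and ix :: "nat \<times> nat \<times> nat \<Rightarrow> nat" and n :: nat and J H K :: "quat mat"
  assumes ix: "bij_betw ix (jordan_index N) {..<n}"
    and J: "J \<in> carrier_mat n n" and H: "H \<in> carrier_mat n n" and K: "K \<in> carrier_mat n n"
    and J_index: "\<And>d i l e j m. (d, i, l) \<in> jordan_index N \<Longrightarrow> (e, j, m) \<in> jordan_index N \<Longrightarrow>
      J $$ (ix (d, i, l), ix (e, j, m)) = (if d = e \<and> i = j \<and> m = Suc l then 1 else 0)"
    and H_hermitian: "conj_transpose H = H"
    and HK: "H * K = 1\<^sub>m n" and KH: "K * H = 1\<^sub>m n"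
    and JH: "conj_transpose J * H = - (H * J)"
begin

lemma dims [simp]:
  "dim_row J = n" "dim_col J = n" "dim_row H = n" "dim_col H = n" "dim_row K = n" "dim_col K = n"
  using J H K by auto

lemma ix_less [simp]: "i < count N d \<Longrightarrow> l < d \<Longrightarrow> ix (d, i, l) < n"
  using bij_betwE[OF ix] by (auto simp: jordan_index_def)

lemma ix_cases:
  assumes "a < n"
  obtains d i l where "a = ix (d, i, l)" "i < count N d" "l < d"
proof -
  from assms have "a \<in> ix ` jordan_index N" using ix by (simp add: bij_betw_def)
  thus ?thesis using that by (auto simp: jordan_index_def)
qed

lemma ix_eq_iff:
  assumes "i < count N d" "l < d" "j < count N e" "m < e"
  shows "ix (d, i, l) = ix (e, j, m) \<longleftrightarrow> d = e \<and> i = j \<and> l = m"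
  using assms inj_onD[OF bij_betw_imp_inj_on[OF ix], of "(d, i, l)" "(e, j, m)"]
  by (auto simp: jordan_index_def)

lemma sum_layer:
  fixes f :: "nat \<Rightarrow> 'b :: comm_monoid_add"
  assumes "l < d" and "\<And>e j m. j < count N e \<Longrightarrow> m < e \<Longrightarrow> \<not> (e = d \<and> m = l) \<Longrightarrow> f (ix (e, j, m)) = 0"
  shows "(\<Sum>k<n. f k) = (\<Sum>j<count N d. f (ix (d, j, l)))"
proof -
  have "(\<Sum>k<n. f k) = (\<Sum>k\<in>(\<lambda>j. ix (d, j, l)) ` {..<count N d}. f k)"
  proof (rule sum.mono_neutral_right)
    show "\<forall>k\<in>{..<n} - (\<lambda>j. ix (d, j, l)) ` {..<count N d}. f k = 0"
    proof
      fix k assume k: "k \<in> {..<n} - (\<lambda>j. ix (d, j, l)) ` {..<count N d}"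
      then obtain e j m where "k = ix (e, j, m)" "j < count N e" "m < e" by (auto elim: ix_cases)
      with k assms(2)[of j e m] show "f k = 0" by auto
    qed
  qed (use assms(1) in auto)
  also have "\<dots> = (\<Sum>j<count N d. f (ix (d, j, l)))"
    using assms(1) by (subst sum.reindex) (auto simp: inj_on_def ix_eq_iff)
  finally show ?thesis .
qed

lemma J_mult_index:
  assumes "Y \<in> carrier_mat n n" "i < count N d" "l < d" "c < n"
  shows "(J * Y) $$ (ix (d, i, l), c) = (if Suc l < d then Y $$ (ix (d, i, Suc l), c) else 0)"
proof -
  have "(J * Y) $$ (ix (d, i, l), c)
      = (\<Sum>k<n. if Suc l < d \<and> k = ix (d, i, Suc l) then Y $$ (ix (d, i, Suc l), c) else 0)"
  proof (subst mat_mult_index[OF J assms(1)], goal_cases)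
    case 3
    show ?case
    proof (rule sum.cong[OF refl])
      fix k assume "k \<in> {..<n}"
      then obtain e j m where k: "k = ix (e, j, m)" "j < count N e" "m < e" by (auto elim: ix_cases)
      show "J $$ (ix (d, i, l), k) * Y $$ (k, c)
          = (if Suc l < d \<and> k = ix (d, i, Suc l) then Y $$ (ix (d, i, Suc l), c) else 0)"
      proof (cases "d = e \<and> i = j \<and> m = Suc l")
        case True
        thus ?thesis using k assms by (simp add: J_index jordan_index_def)
      next
        case False
        hence "\<not> (Suc l < d \<and> k = ix (d, i, Suc l))" using k assms by (auto simp: ix_eq_iff)
        moreover have "J $$ (ix (d, i, l), k) = 0" using k assms False by (auto simp: J_index jordan_index_def)
        ultimately show ?thesis by auto
      qed
    qed
  qed (use assms in auto)
  also have "\<dots> = (if Suc l < d then Y $$ (ix (d, i, Suc l), c) else 0)"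
    using assms by (cases "Suc l < d") auto
  finally show ?thesis .
qed

lemma mult_J_index:
  assumes "Y \<in> carrier_mat n n" "j < count N e" "m < e" "r < n"
  shows "(Y * J) $$ (r, ix (e, j, m)) = (if m = 0 then 0 else Y $$ (r, ix (e, j, m - 1)))"
proof -
  have "(Y * J) $$ (r, ix (e, j, m))
      = (\<Sum>k<n. if m \<noteq> 0 \<and> k = ix (e, j, m - 1) then Y $$ (r, ix (e, j, m - 1)) else 0)"
  proof (subst mat_mult_index[OF assms(1) J], goal_cases)
    case 3
    show ?case
    proof (rule sum.cong[OF refl])
      fix k assume "k \<in> {..<n}"
      then obtain d i l where k: "k = ix (d, i, l)" "i < count N d" "l < d" by (auto elim: ix_cases)
      show "Y $$ (r, k) * J $$ (k, ix (e, j, m))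
          = (if m \<noteq> 0 \<and> k = ix (e, j, m - 1) then Y $$ (r, ix (e, j, m - 1)) else 0)"
      proof (cases "d = e \<and> i = j \<and> m = Suc l")
        case True
        thus ?thesis using k assms by (simp add: J_index jordan_index_def)
      next
        case False
        hence "\<not> (m \<noteq> 0 \<and> k = ix (e, j, m - 1))" using k assms by (auto simp: ix_eq_iff)
        moreover have "J $$ (k, ix (e, j, m)) = 0" using k assms False by (auto simp: J_index jordan_index_def)
        ultimately show ?thesis by auto
      qed
    qed
  qed (use assms in auto)
  also have "\<dots> = (if m = 0 then 0 else Y $$ (r, ix (e, j, m - 1)))"
    using assms by (cases "m = 0") auto
  finally show ?thesis .
qed

lemma K_hermitian: "conj_transpose K = K"
proof -
  have "conj_transpose K * H = 1\<^sub>m n"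
    using arg_cong[OF HK, of conj_transpose] by (simp add: mat_conj_transpose_mult H_hermitian conj_transpose_one)
  hence "conj_transpose K * H * K = K" by simp
  moreover have "conj_transpose K * H * K = conj_transpose K" by (simp add: mat_assoc HK)
  ultimately show ?thesis by simp
qed

lemma JK: "J * K = - (K * conj_transpose J)"
proof -
  have "K * (conj_transpose J * H) * K = - (K * (H * J) * K)" by (simp add: JH)
  moreover have "K * (conj_transpose J * H) * K = K * conj_transpose J * (H * K)" by (simp add: mat_assoc)
  moreover have "K * (H * J) * K = K * H * (J * K)" by (simp add: mat_assoc)
  ultimately show ?thesis by (simp add: HK KH)
qed

text \<open>Commuting and anticommuting matrices have the same zero pattern; the sign matters only
  for values along diagonals.\<close>

definition intertwines :: "quat mat \<Rightarrow> bool" where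
  "intertwines Y \<longleftrightarrow> Y \<in> carrier_mat n n \<and> (Y * J = J * Y \<or> Y * J = - (J * Y))"

text \<open>Comparing entries of \<open>Y * J\<close> and \<open>J * Y\<close> relates neighbours on
  a diagonal up to sign; at the border of a block one side is zero.\<close>

lemma intertwines_step:
  assumes Y: "intertwines Y" and i: "i < count N d" and j: "j < count N e" and l: "l < d" and m: "m < e"
  shows "Suc l < d \<Longrightarrow> m = 0 \<Longrightarrow> Y $$ (ix (d, i, Suc l), ix (e, j, m)) = 0"
    and "Suc l = d \<Longrightarrow> m \<noteq> 0 \<Longrightarrow> Y $$ (ix (d, i, l), ix (e, j, m - 1)) = 0"
    and "Suc l < d \<Longrightarrow> m \<noteq> 0 \<Longrightarrow> Y * J = J * Y \<Longrightarrow>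
      Y $$ (ix (d, i, Suc l), ix (e, j, m)) = Y $$ (ix (d, i, l), ix (e, j, m - 1))"
    and "Suc l < d \<Longrightarrow> m \<noteq> 0 \<Longrightarrow> Y * J = - (J * Y) \<Longrightarrow>
      Y $$ (ix (d, i, Suc l), ix (e, j, m)) = - Y $$ (ix (d, i, l), ix (e, j, m - 1))"
proof -
  from Y have Yc: "Y \<in> carrier_mat n n" and Y': "Y * J = J * Y \<or> Y * J = - (J * Y)"
    by (auto simp: intertwines_def)
  have [simp]: "dim_row Y = n" "dim_col Y = n" using Yc by auto
  note [simp del] = index_mult_mat(1)
  note 1 = J_mult_index[OF Yc i l ix_less[OF j m]] and 2 = mult_J_index[OF Yc j m ix_less[OF i l]]
  have 3: "(Y * J) $$ (ix (d, i, l), ix (e, j, m)) = (J * Y) $$ (ix (d, i, l), ix (e, j, m))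
     \<or> (Y * J) $$ (ix (d, i, l), ix (e, j, m)) = - (J * Y) $$ (ix (d, i, l), ix (e, j, m))"
    using Y' i j l m by auto
  show "Suc l < d \<Longrightarrow> m = 0 \<Longrightarrow> Y $$ (ix (d, i, Suc l), ix (e, j, m)) = 0"
    and "Suc l = d \<Longrightarrow> m \<noteq> 0 \<Longrightarrow> Y $$ (ix (d, i, l), ix (e, j, m - 1)) = 0"
    using 3 unfolding 1 2 by auto
  show "Y $$ (ix (d, i, Suc l), ix (e, j, m)) = Y $$ (ix (d, i, l), ix (e, j, m - 1))"
    if "Suc l < d" "m \<noteq> 0" "Y * J = J * Y"
    using 1 2 that by simp
  show "Y $$ (ix (d, i, Suc l), ix (e, j, m)) = - Y $$ (ix (d, i, l), ix (e, j, m - 1))"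
    if "Suc l < d" "m \<noteq> 0" "Y * J = - (J * Y)"
  proof -
    have "(Y * J) $$ (ix (d, i, l), ix (e, j, m)) = - (J * Y) $$ (ix (d, i, l), ix (e, j, m))"
      unfolding that(3) using i j l m by simp
    thus ?thesis using that unfolding 1 2 by simp
  qed
qed

lemma intertwines_step0:
  assumes "intertwines Y" "i < count N d" "j < count N e" "Suc l < d" "Suc m < e"
  shows "Y $$ (ix (d, i, Suc l), ix (e, j, Suc m)) = 0 \<longleftrightarrow> Y $$ (ix (d, i, l), ix (e, j, m)) = 0"
  using intertwines_step(3,4)[OF assms(1-3), of l "Suc m"] assms by (auto simp: intertwines_def)

text \<open>Following the diagonal back to column \<open>0\<close> ends in a row other than
  \<open>0\<close>, where the entry vanishes.\<close>

lemma intertwines_zero_below: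
  assumes Y: "intertwines Y" and i: "i < count N d" and j: "j < count N e"
  shows "l < d \<Longrightarrow> m < e \<Longrightarrow> m < l \<Longrightarrow> Y $$ (ix (d, i, l), ix (e, j, m)) = 0"
proof (induction m arbitrary: l)
  case 0
  then show ?case using intertwines_step(1)[OF Y i j, of "l - 1" 0] by simp
next
  case (Suc m)
  then show ?case using intertwines_step0[OF Y i j, of "l - 1" m] Suc.IH[of "l - 1"] by simp
qed

text \<open>Following the diagonal forward to the last row ends before the last column, where the
  entry vanishes.\<close>

lemma intertwines_zero_above:
  assumes Y: "intertwines Y" and i: "i < count N d" and j: "j < count N e"
  shows "l < d \<Longrightarrow> m < e \<Longrightarrow> m + d < l + e \<Longrightarrow> Y $$ (ix (d, i, l), ix (e, j, m)) = 0"
proof (induction "d - l" arbitrary: l m)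
  case (Suc k)
  show ?case
  proof (cases "Suc l < d")
    case True
    with Suc show ?thesis
      using intertwines_step0[OF Y i j, of l m] Suc(1)[of "Suc l" "Suc m"] by simp
  next
    case False
    with Suc show ?thesis using intertwines_step(2)[OF Y i j, of l "Suc m"] by simp
  qed
qed simp

lemma anticommute_diag:
  assumes Y: "intertwines Y" and Y': "Y * J = - (J * Y)" and i: "i < count N d" and j: "j < count N d"
  shows "l < d \<Longrightarrow> Y $$ (ix (d, i, l), ix (d, j, l)) = (- 1) ^ l * Y $$ (ix (d, i, 0), ix (d, j, 0))"
proof (induction l)
  case (Suc l)
  thus ?case using intertwines_step(4)[OF Y i j, of l "Suc l"] Y' by simp
qed simp

lemma commute_diag:
  assumes Y: "intertwines Y" and Y': "Y * J = J * Y" and i: "i < count N d" and j: "j < count N d"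
  shows "l < d \<Longrightarrow> Y $$ (ix (d, i, l), ix (d, j, l)) = Y $$ (ix (d, i, 0), ix (d, j, 0))"
proof (induction l)
  case (Suc l)
  thus ?case using intertwines_step(3)[OF Y i j, of l "Suc l"] Y' by simp
qed simp

lemma H_sym: "i < count N d \<Longrightarrow> j < count N e \<Longrightarrow> l < d \<Longrightarrow> m < e \<Longrightarrow>
    H $$ (ix (d, i, l), ix (e, j, m)) = qcnj (H $$ (ix (e, j, m), ix (d, i, l)))"
  by (subst H_hermitian[symmetric]) simp

lemma K_sym: "i < count N d \<Longrightarrow> j < count N e \<Longrightarrow> l < d \<Longrightarrow> m < e \<Longrightarrow>
    K $$ (ix (d, i, l), ix (e, j, m)) = qcnj (K $$ (ix (e, j, m), ix (d, i, l)))"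
  by (subst K_hermitian[symmetric]) simp

text \<open>Skew-adjointness of \<open>J\<close> entry by entry: neighbours on an antidiagonal of
  \<open>H\<close> differ by a sign, with zeros beyond its ends.\<close>

lemma H_step:
  assumes i: "i < count N d" and j: "j < count N e" and l: "l < d" and m: "m < e"
  shows "(if l = 0 then 0 else H $$ (ix (d, i, l - 1), ix (e, j, m)))
    = - (if m = 0 then 0 else H $$ (ix (d, i, l), ix (e, j, m - 1)))"
proof -
  note [simp del] = index_mult_mat(1)
  have "(conj_transpose J * H) = conj_transpose (H * J)"
    by (simp add: mat_conj_transpose_mult H_hermitian)
  moreover have "conj_transpose (H * J) $$ (ix (d, i, l), ix (e, j, m))
      = (if l = 0 then 0 else H $$ (ix (d, i, l - 1), ix (e, j, m)))"
    using i j l m by (simp add: mult_J_index[OF H i l ix_less[OF j m]] H_sym[of j e i d m "l - Suc 0"])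
  moreover have "(- (H * J)) $$ (ix (d, i, l), ix (e, j, m))
      = - (if m = 0 then 0 else H $$ (ix (d, i, l), ix (e, j, m - 1)))"
    using i j l m by (simp add: mult_J_index[OF H j m])
  ultimately show ?thesis using JH by simp
qed

lemma K_step:
  assumes i: "i < count N d" and j: "j < count N e" and l: "l < d" and m: "m < e"
  shows "(if Suc l < d then K $$ (ix (d, i, Suc l), ix (e, j, m)) else 0)
    = - (if Suc m < e then K $$ (ix (d, i, l), ix (e, j, Suc m)) else 0)"
proof -
  note [simp del] = index_mult_mat(1)
  have "K * conj_transpose J = conj_transpose (J * K)"
    by (simp add: mat_conj_transpose_mult K_hermitian)
  moreover have "(- conj_transpose (J * K)) $$ (ix (d, i, l), ix (e, j, m))
      = - (if Suc m < e then K $$ (ix (d, i, l), ix (e, j, Suc m)) else 0)"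
    using i j l m by (simp add: J_mult_index[OF K j m] K_sym[of j e i d "Suc m" l])
  moreover have "(J * K) $$ (ix (d, i, l), ix (e, j, m))
      = (if Suc l < d then K $$ (ix (d, i, Suc l), ix (e, j, m)) else 0)"
    using i j l m by (simp add: J_mult_index[OF K i l])
  ultimately show ?thesis using JK by simp
qed

lemma H_zero:
  assumes i: "i < count N d" and j: "j < count N e"
  shows "l < d \<Longrightarrow> m < e \<Longrightarrow> l + m + 1 < d \<or> l + m + 1 < e \<Longrightarrow> H $$ (ix (d, i, l), ix (e, j, m)) = 0"
proof -
  have 1: "l < d \<Longrightarrow> m < e \<Longrightarrow> l + m + 1 < d \<Longrightarrow> H $$ (ix (d, i, l), ix (e, j, m)) = 0"
    if "i < count N d" "j < count N e" for d i l e j m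
  proof (induction m arbitrary: l)
    case 0
    thus ?case using H_step[OF that, of "Suc l" 0] by simp
  next
    case (Suc m)
    thus ?case using H_step[OF that, of "Suc l" "Suc m"] Suc.IH[of "Suc l"] by simp
  qed
  show "l < d \<Longrightarrow> m < e \<Longrightarrow> l + m + 1 < d \<or> l + m + 1 < e \<Longrightarrow> H $$ (ix (d, i, l), ix (e, j, m)) = 0"
    using 1[OF i j, of l m] 1[OF j i, of m l] H_sym[OF i j, of l m] by (auto simp: add.commute)
qed

text \<open>The inverse is supported on the opposite side of the antidiagonal from \<open>H\<close>.
  This makes the two meet in a single layer in \<open>Mform_Nform\<close>.\<close>

lemma K_zero:
  assumes i: "i < count N d" and j: "j < count N e"
  shows "l < d \<Longrightarrow> m < e \<Longrightarrow> d \<le> l + m \<or> e \<le> l + m \<Longrightarrow> K $$ (ix (d, i, l), ix (e, j, m)) = 0"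
proof -
  have 1: "l < d \<Longrightarrow> m < e \<Longrightarrow> d \<le> l + m \<Longrightarrow> K $$ (ix (d, i, l), ix (e, j, m)) = 0"
    if "i < count N d" "j < count N e" for d i l e j m
  proof (induction m arbitrary: l)
    case (Suc m)
    show ?case
    proof (cases "Suc l < d")
      case True
      with Suc show ?thesis using K_step[OF that, of l m] Suc.IH[of "Suc l"] by simp
    next
      case False
      with Suc show ?thesis using K_step[OF that, of l m] by simp
    qed
  qed simp
  show "l < d \<Longrightarrow> m < e \<Longrightarrow> d \<le> l + m \<or> e \<le> l + m \<Longrightarrow> K $$ (ix (d, i, l), ix (e, j, m)) = 0"
    using 1[OF i j, of l m] 1[OF j i, of m l] K_sym[OF i j, of l m] by (auto simp: add.commute)
qed

lemma H_antidiag: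
  assumes i: "i < count N d" and j: "j < count N d"
  shows "l < d \<Longrightarrow> H $$ (ix (d, i, l), ix (d, j, d - 1 - l)) = (- 1) ^ l * H $$ (ix (d, i, 0), ix (d, j, d - 1))"
proof (induction l)
  case (Suc l)
  have "H $$ (ix (d, i, l), ix (d, j, d - 1 - l)) = - H $$ (ix (d, i, Suc l), ix (d, j, d - 1 - Suc l))"
    using H_step[OF i j, of "Suc l" "d - 1 - l"] Suc.prems by (simp add: Suc_diff_Suc)
  with Suc show ?case by (simp add: minus_equation_iff)
qed simp

section \<open>Forms and maps induced on the top vectors of the Jordan blocks\<close>

subsection \<open>Multiplicity spaces\<close>

definition block :: "nat \<Rightarrow> nat \<Rightarrow> nat \<Rightarrow> quat mat \<Rightarrow> quat mat" where
  "block d l m Y = mat (count N d) (count N d) (\<lambda>(i, j). Y $$ (ix (d, i, l), ix (d, j, m)))"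

lemma block_carrier [simp]: "block d l m Y \<in> carrier_mat (count N d) (count N d)"
  and dim_block [simp]: "dim_row (block d l m Y) = count N d" "dim_col (block d l m Y) = count N d"
  and block_index [simp]: "i < count N d \<Longrightarrow> j < count N d \<Longrightarrow>
    block d l m Y $$ (i, j) = Y $$ (ix (d, i, l), ix (d, j, m))"
  by (simp_all add: block_def)

text \<open>If every intermediate index outside layer \<open>k\<close> of the size \<open>d\<close>
  contributes a zero factor, the sum over all indices collapses to one product of blocks.\<close>

lemma block_mult:
  assumes Y: "Y \<in> carrier_mat n n" and Z: "Z \<in> carrier_mat n n" and "l < d" "m < d" "k < d"
    and "\<And>i c e j p. i < count N d \<Longrightarrow> c < count N d \<Longrightarrow> j < count N e \<Longrightarrow> p < e \<Longrightarrow> \<not> (e = d \<and> p = k) \<Longrightarrow>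
      Y $$ (ix (d, i, l), ix (e, j, p)) = 0 \<or> Z $$ (ix (e, j, p), ix (d, c, m)) = 0"
  shows "block d l m (Y * Z) = block d l k Y * block d k m Z"
proof (rule eq_matI)
  fix i c assume "i < dim_row (block d l k Y * block d k m Z)" "c < dim_col (block d l k Y * block d k m Z)"
  hence ic: "i < count N d" "c < count N d" by auto
  have "block d l m (Y * Z) $$ (i, c) = (\<Sum>p<n. Y $$ (ix (d, i, l), p) * Z $$ (p, ix (d, c, m)))"
    using ic assms by (simp add: mat_mult_index[OF Y Z] del: index_mult_mat(1))
  also have "\<dots> = (\<Sum>j<count N d. Y $$ (ix (d, i, l), ix (d, j, k)) * Z $$ (ix (d, j, k), ix (d, c, m)))"
    using assms ic by (intro sum_layer) (metis mult_zero_left mult_zero_right)+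
  also have "\<dots> = (block d l k Y * block d k m Z) $$ (i, c)"
    using ic by (subst mat_mult_index[OF block_carrier block_carrier]) auto
  finally show "block d l m (Y * Z) $$ (i, c) = (block d l k Y * block d k m Z) $$ (i, c)" .
qed auto

text \<open>\<open>top_block\<close> is the map induced on the multiplicity space of size
  \<open>d\<close>. \<open>Mform\<close> represents \<open><J^(d-1) v, w>\<close> on top vectors,
  since \<open>J^(d-1)\<close> carries the top to position \<open>0\<close>.\<close>

abbreviation "top_block d \<equiv> block d (d - 1) (d - 1)"
abbreviation "Mform d \<equiv> block d 0 (d - 1) H"
abbreviation "Nform d \<equiv> block d (d - 1) 0 K"

lemma intertwines_carrier: "intertwines Y \<Longrightarrow> Y \<in> carrier_mat n n"
  by (simp add: intertwines_def)

lemma top_mult: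
  assumes Y: "intertwines Y" and Z: "intertwines Z" and d: "d > 0"
  shows "top_block d (Y * Z) = top_block d Y * top_block d Z"
proof (rule block_mult[OF intertwines_carrier[OF Y] intertwines_carrier[OF Z]])
  fix i c e j p
  assume *: "i < count N d" "c < count N d" "j < count N e" "p < e" "\<not> (e = d \<and> p = d - 1)"
  \<comment> \<open>Positions below the top are excluded by \<open>Y\<close>, those beyond
    \<open>d - 1\<close> by \<open>Z\<close>; at position \<open>d - 1\<close> itself a longer block
    is excluded by \<open>Y\<close>.\<close>
  hence "p < d - 1 \<or> p + d < d - 1 + e \<or> d - 1 < p" by linarith
  thus "Y $$ (ix (d, i, d - 1), ix (e, j, p)) = 0 \<or> Z $$ (ix (e, j, p), ix (d, c, d - 1)) = 0"
    using * d intertwines_zero_below[OF Y *(1,3), of "d - 1" p]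
      intertwines_zero_above[OF Y *(1,3), of "d - 1" p] intertwines_zero_below[OF Z *(3,2), of p "d - 1"]
    by auto
qed (use d in auto)

lemma top_one: "d > 0 \<Longrightarrow> top_block d (1\<^sub>m n) = 1\<^sub>m (count N d)"
  by (rule eq_matI) (auto simp: ix_eq_iff)

text \<open>At layer \<open>0\<close> of \<open>H * K\<close> the zero patterns leave only position
  \<open>d - 1\<close> in blocks of size \<open>d\<close>. So the induced form is
  nondegenerate.\<close>

lemma Mform_Nform:
  assumes d: "d > 0"
  shows "Mform d * Nform d = 1\<^sub>m (count N d)" "Nform d * Mform d = 1\<^sub>m (count N d)"
proof -
  have "block d 0 0 (H * K) = Mform d * Nform d"
  proof (rule block_mult[OF H K])
    fix i c e j p
    assume *: "i < count N d" "c < count N d" "j < count N e" "p < e" "\<not> (e = d \<and> p = d - 1)"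
    hence "p + 1 < d \<or> p + 1 < e \<or> d \<le> p" by linarith
    thus "H $$ (ix (d, i, 0), ix (e, j, p)) = 0 \<or> K $$ (ix (e, j, p), ix (d, c, 0)) = 0"
      using * d H_zero[OF *(1,3), of 0 p] K_zero[OF *(3,2), of p 0] by auto
  qed (use d in auto)
  moreover have "block d 0 0 (H * K) = 1\<^sub>m (count N d)"
    unfolding HK using d by (intro eq_matI) (auto simp: ix_eq_iff)
  ultimately show "Mform d * Nform d = 1\<^sub>m (count N d)" by simp
  thus "Nform d * Mform d = 1\<^sub>m (count N d)"
    by (rule quat_mat_left_right_inverse[OF block_carrier block_carrier])
qed

text \<open>Crossing the antidiagonal from corner to corner costs
  \<open>(- 1) ^ (d - 1) = - 1\<close>, while \<open>H\<close> itself is Hermitian.\<close>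

lemma Mform_skew:
  assumes "even d" "d > 0"
  shows "conj_transpose (Mform d) = - Mform d"
proof (rule eq_matI)
  fix i j assume "i < dim_row (- Mform d)" "j < dim_col (- Mform d)"
  hence ij: "i < count N d" "j < count N d" by auto
  have "conj_transpose (Mform d) $$ (i, j) = H $$ (ix (d, i, d - 1), ix (d, j, 0))"
    using ij assms H_sym[OF ij, of "d - 1" 0] by simp
  also have "\<dots> = (- Mform d) $$ (i, j)"
    using ij assms H_antidiag[OF ij, of "d - 1"] by simp
  finally show "conj_transpose (Mform d) $$ (i, j) = (- Mform d) $$ (i, j)" .
qed auto

text \<open>\<open>K * (conj_transpose Y * H)\<close> is the adjoint of \<open>Y\<close> for the
  form. Adjoints reverse products and negate \<open>J\<close>.\<close>

lemma adjoint_anticommutes: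
  assumes Y: "Y \<in> carrier_mat n n" "Y * J = - (J * Y)"
  shows "K * (conj_transpose Y * H) * J = - (J * (K * (conj_transpose Y * H)))"
proof -
  have [simp]: "dim_row Y = n" "dim_col Y = n" using Y by auto
  have 1: "H * J = - (conj_transpose J * H)" by (simp add: JH)
  have 2: "conj_transpose Y * conj_transpose J = - (conj_transpose J * conj_transpose Y)"
    using arg_cong[OF Y(2), of conj_transpose] by (simp add: mat_conj_transpose_mult)
  have "J * (K * (conj_transpose Y * H)) = J * K * (conj_transpose Y * H)" by (simp add: mat_assoc)
  also have "\<dots> = - (K * (conj_transpose J * conj_transpose Y * H))" unfolding JK by (simp add: mat_assoc)
  also have "conj_transpose J * conj_transpose Y = - (conj_transpose Y * conj_transpose J)" unfolding 2 by simp
  also have "- (K * (- (conj_transpose Y * conj_transpose J) * H)) = K * (conj_transpose Y * (conj_transpose J * H))"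
    by (simp add: mat_assoc)
  also have "\<dots> = - (K * (conj_transpose Y * H) * J)" unfolding JH by (simp add: mat_assoc)
  finally show ?thesis by simp
qed

text \<open>Pairing the top with position \<open>0\<close> brings in the block of \<open>Y\<close>
  at position \<open>0\<close>, which differs from the top block by \<open>(- 1) ^ (d - 1)\<close>
  because \<open>Y\<close> anticommutes with \<open>J\<close>.\<close>

lemma top_adjoint:
  assumes Y: "intertwines Y" and anti: "Y * J = - (J * Y)" and d: "d > 0"
  shows "top_block d (K * (conj_transpose Y * H)) = rscale ((- 1) ^ (d - 1)) (Nform d * (conj_transpose (top_block d Y) * Mform d))"
proof -
  note Yc = intertwines_carrier[OF Y]
  have [simp]: "dim_row Y = n" "dim_col Y = n" using Yc by auto
  have Y': "conj_transpose Y \<in> carrier_mat n n" using Yc by simp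
  hence YH: "conj_transpose Y * H \<in> carrier_mat n n" using H by simp
  \<comment> \<open>The case \<open>e = d\<close> isolates one layer in
    \<open>conj_transpose Y * H\<close>; the case \<open>e > d\<close> makes entries of this product
    vanish, as the product with \<open>K\<close> requires.\<close>
  have Y0: "conj_transpose Y $$ (ix (e, j, 0), ix (f, k, p)) = 0 \<or> H $$ (ix (f, k, p), ix (d, c, d - 1)) = 0"
    if *: "j < count N e" "k < count N f" "c < count N d" "p < f" "d \<le> e" "\<not> (f = d \<and> p = 0 \<and> e = d)"
    for e j f k p c
  proof -
    have e: "0 < e" using that d by simp
    have "p > 0 \<or> f < e \<or> p + (d - 1) + 1 < f" using that d by auto
    thus ?thesis
      using * e d intertwines_zero_below[OF Y *(2,1), of p 0]
        intertwines_zero_above[OF Y *(2,1), of p 0] H_zero[OF *(2,3), of p "d - 1"] by auto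
  qed
  have YH0: "(conj_transpose Y * H) $$ (ix (e, j, 0), ix (d, c, d - 1)) = 0"
    if *: "j < count N e" "c < count N d" "d < e" for e j c
  proof -
    have "conj_transpose Y $$ (ix (e, j, 0), q) * H $$ (q, ix (d, c, d - 1)) = 0" if q: "q < n" for q
    proof -
      from q obtain f k p where "q = ix (f, k, p)" "k < count N f" "p < f" by (auto elim: ix_cases)
      with Y0[OF *(1) this(2) *(2) this(3)] *(3) show ?thesis by auto
    qed
    thus ?thesis using * d by (subst mat_mult_index[OF Y' H]) (auto intro!: sum.neutral simp del: mult_eq_0_iff)
  qed
  have "top_block d (K * (conj_transpose Y * H)) = Nform d * block d 0 (d - 1) (conj_transpose Y * H)"
  proof (rule block_mult[OF K YH])
    fix i c e j p
    assume *: "i < count N d" "c < count N d" "j < count N e" "p < e" "\<not> (e = d \<and> p = 0)"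
    hence "d \<le> d - 1 + p \<or> e \<le> d - 1 + p \<or> p = 0 \<and> d < e" using d by linarith
    thus "K $$ (ix (d, i, d - 1), ix (e, j, p)) = 0 \<or> (conj_transpose Y * H) $$ (ix (e, j, p), ix (d, c, d - 1)) = 0"
      using * d K_zero[OF *(1,3), of "d - 1" p] YH0[OF *(3,2)] by (metis diff_less less_one)
  qed (use d in auto)
  also have "block d 0 (d - 1) (conj_transpose Y * H) = block d 0 0 (conj_transpose Y) * Mform d"
    by (rule block_mult[OF Y' H]) (use d Y0 in auto)
  also have "block d 0 0 (conj_transpose Y) = rscale ((- 1) ^ (d - 1)) (conj_transpose (top_block d Y))"
  proof (rule eq_matI, goal_cases)
    case (1 i j)
    hence ij: "i < count N d" "j < count N d" by auto
    have "quat_of_real ((- 1) ^ k) = (- 1) ^ k" for k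
      by (simp add: minus_one_power_iff) (simp add: quat_of_real_def one_quat_def uminus_quat_def)
    moreover have "(- 1) ^ (d - 1) * (x * (- 1) ^ (d - 1)) = x" for x :: quat
      by (simp add: minus_one_power_iff)
    ultimately show ?case
      using ij d anticommute_diag[OF Y anti ij(2,1), of "d - 1"] by simp
  qed auto
  finally show ?thesis by (simp add: mat_rscale_mult)
qed

end

context hermitian_jordan
begin

section \<open>Parity of multiplicities, and construction of the involution\<close>

subsection \<open>Involutions\<close>

lemma even_count_of_involution:
  assumes T: "T \<in> carrier_mat n n" "T * T = 1\<^sub>m n" "T * J = - (J * T)" "conj_transpose T * H = H * T"
    and d: "even d" "d > 0"
  shows "even (count N d)"
proof -
  let ?S = "top_block d T" and ?t = "count N d"
  have [simp]: "dim_row T = n" "dim_col T = n" using T by auto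
  have iT: "intertwines T" using T by (simp add: intertwines_def)
  \<comment> \<open>\<open>T\<close> is its own adjoint, so \<open>top_adjoint\<close> relates
    \<open>?S\<close> to its conjugate transpose, with sign \<open>- 1\<close> for even
    \<open>d\<close>.\<close>
  have "K * (conj_transpose T * H) = K * H * T" unfolding T(4) by (simp add: mat_assoc)
  hence adj: "K * (conj_transpose T * H) = T" by (simp add: KH)
  have SS: "?S * ?S = 1\<^sub>m ?t" using top_mult[OF iT iT d(2)] top_one[OF d(2)] T(2) by simp
  have "?S = rscale (- 1) (Nform d * (conj_transpose ?S * Mform d))"
    using top_adjoint[OF iT T(3) d(2)] adj d by simp
  hence "real_trace ?S = - real_trace (Nform d * (conj_transpose ?S * Mform d))"
    using real_trace_rscale[of "Nform d * (conj_transpose ?S * Mform d)" ?t "- 1"] by (metis block_carrier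
        conj_transpose_carrier_iff mult_carrier_mat mult_minus1)
  also have "real_trace (Nform d * (conj_transpose ?S * Mform d)) = real_trace (conj_transpose ?S * Mform d * Nform d)"
    by (rule real_trace_commute[of _ ?t ?t]) (auto intro: carrier_matI)
  also have "conj_transpose ?S * Mform d * Nform d = conj_transpose ?S"
    by (simp add: mat_assoc Mform_Nform(1)[OF d(2)] del: One_nat_def)
  also have "real_trace (conj_transpose ?S) = real_trace ?S" by (rule real_trace_conj_transpose[OF block_carrier])
  finally have tr: "real_trace ?S = 0" by simp
  \<comment> \<open>The trace of this idempotent is its rank \<open>r\<close>, whence
    \<open>count N d = 2 r\<close>.\<close>
  let ?E = "rscale (1/2) (1\<^sub>m ?t + ?S)"
  have E: "?E \<in> carrier_mat ?t ?t" by (auto intro: carrier_matI)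
  have "?E * ?E = ?E" by (rule idempotent_of_involution[OF block_carrier SS])
  with E obtain r where "real_trace ?E = real r" by (rule idempotent_real_trace)
  moreover have "real_trace ?E = real ?t / 2"
    using tr by (simp add: real_trace_rscale[of _ ?t] real_trace_add[of _ ?t])
  ultimately have "real ?t = real (2 * r)" by simp
  thus ?thesis using of_nat_eq_iff by (metis dvd_triv_left)
qed

definition jx :: "nat \<Rightarrow> nat \<times> nat \<times> nat" where
  "jx = inv_into (jordan_index N) ix"

lemma jx_ix [simp]: "i < count N d \<Longrightarrow> l < d \<Longrightarrow> jx (ix (d, i, l)) = (d, i, l)"
  unfolding jx_def by (rule inv_into_f_f[OF bij_betw_imp_inj_on[OF ix]]) (simp add: jordan_index_def)

text \<open>A lexicographic order: first by position, then larger blocks first. \<open>Suc n\<close>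
  exceeds every block size, and \<open>Suc l\<close> in place of \<open>l\<close> keeps the
  truncated subtraction exact.\<close>

definition weight :: "nat \<Rightarrow> nat" where
  "weight a = (case jx a of (d, i, l) \<Rightarrow> Suc l * Suc n - d)"

lemma part_le: "i < count N d \<Longrightarrow> d \<le> n"
proof -
  assume i: "i < count N d"
  have "card {..<d} \<le> card {..<n}"
    by (rule card_inj_on_le[of "\<lambda>l. ix (d, i, l)"]) (use i in \<open>auto simp: inj_on_def ix_eq_iff\<close>)
  thus ?thesis by simp
qed

lemma weight_less: "a < n \<Longrightarrow> weight a < Suc n * Suc n"
proof (erule ix_cases)
  fix d i l assume *: "a = ix (d, i, l)" "i < count N d" "l < d"
  hence "weight a < Suc l * Suc n" by (simp add: weight_def)
  also have "Suc l * Suc n \<le> Suc n * Suc n" using * part_le[of i d] by (intro mult_le_mono1) simp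
  finally show "weight a < Suc n * Suc n" .
qed

text \<open>A nonzero entry has its column at a later position than its row, or at the same position
  in a block that is not larger. Equal position and size are excluded by
  \<open>commute_diag\<close>, which equates such an entry with one of the vanishing top
  block.\<close>

lemma mat_gap_commuting:
  assumes Y: "intertwines Y" and comm: "Y * J = J * Y"
    and top: "\<And>d. d > 0 \<Longrightarrow> top_block d Y = 0\<^sub>m (count N d) (count N d)"
  shows "mat_gap weight 1 Y"
  unfolding mat_gap_def
proof (intro allI impI)
  fix a b assume ab: "a < dim_row Y" "b < dim_col Y" and nz: "Y $$ (a, b) \<noteq> 0"
  have "a < n" "b < n" using ab intertwines_carrier[OF Y] by auto
  then obtain d i l e j m where a: "a = ix (d, i, l)" "i < count N d" "l < d"
    and b: "b = ix (e, j, m)" "j < count N e" "m < e" by (elim ix_cases)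
  have "l \<le> m" "l + e \<le> m + d"
    using nz a b intertwines_zero_below[OF Y a(2) b(2), of l m] intertwines_zero_above[OF Y a(2) b(2), of l m]
    by (auto simp: not_le[symmetric])
  have de: "d \<le> n" "e \<le> n" using part_le a b by auto
  have "Suc l * Suc n + e < Suc m * Suc n + d"
  proof (cases "l = m")
    case True
    have "e \<noteq> d"
    proof
      assume ed: "e = d"
      have "Y $$ (ix (d, i, d - 1), ix (d, j, d - 1)) = 0"
        using top[of d] a b ed by (metis block_index gr_implies_not0 index_zero_mat(1) neq0_conv)
      hence "Y $$ (ix (d, i, l), ix (d, j, l)) = 0"
        using commute_diag[OF Y comm, of i d j l] commute_diag[OF Y comm, of i d j "d - 1"] a b ed by simp
      with nz a b True ed show False by simp
    qed
    thus ?thesis using True \<open>l + e \<le> m + d\<close> by simp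
  next
    case False
    hence "Suc (Suc l) * Suc n \<le> Suc m * Suc n" using \<open>l \<le> m\<close> by (intro mult_le_mono1) simp
    thus ?thesis using de a b by simp
  qed
  moreover have "d \<le> Suc l * Suc n" "e \<le> Suc m * Suc n" using de by simp_all
  ultimately show "weight a + 1 \<le> weight b" using a b by (simp add: weight_def)
qed

lemma self_adjoint_involution:
  assumes even: "\<And>d. even d \<Longrightarrow> even (count N d)"
  shows "\<exists>T \<in> carrier_mat n n. T * T = 1\<^sub>m n \<and> conj_transpose T * H = H * T \<and> T * J = - (J * T)"
proof -
  have "\<exists>S. S \<in> carrier_mat (count N d) (count N d) \<and> S * S = 1\<^sub>m (count N d) \<and>
      rscale ((- 1) ^ (d - 1)) (Nform d * (conj_transpose S * Mform d)) = S" if d: "d > 0" for d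
  proof (cases "even d")
    case True
    obtain S where S: "S \<in> carrier_mat (count N d) (count N d)" "S * S = 1\<^sub>m (count N d)"
      and SM: "conj_transpose S * Mform d = - (Mform d * S)"
      using skew_hermitian_negating_involution[OF block_carrier Mform_skew[OF True d] block_carrier
          Mform_Nform(2)[OF d] even[OF True]] by blast
    have [simp]: "dim_row S = count N d" "dim_col S = count N d" using S by auto
    have "Nform d * (conj_transpose S * Mform d) = - (Nform d * Mform d * S)"
      unfolding SM by (simp add: mat_assoc)
    hence "rscale (- 1) (Nform d * (conj_transpose S * Mform d)) = S"
      by (simp add: Mform_Nform(2)[OF d] rscale_def del: One_nat_def)
        (rule eq_matI; simp add: quat_of_real_def times_quat_def uminus_quat_def)
    thus ?thesis using S True d by (intro exI[of _ S]) simp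
  next
    case False
    \<comment> \<open>For odd \<open>d\<close> the sign is \<open>1\<close>, so the identity
      satisfies the adjoint relation.\<close>
    hence "rscale ((- 1) ^ (d - 1)) (Nform d * (conj_transpose (1\<^sub>m (count N d)) * Mform d)) = 1\<^sub>m (count N d)"
      by (simp add: conj_transpose_one Mform_Nform(2)[OF d] rscale_def del: One_nat_def) (rule eq_matI; simp)
    thus ?thesis by (intro exI[of _ "1\<^sub>m (count N d)"]) simp
  qed
  then obtain S where S: "\<And>d. d > 0 \<Longrightarrow> S d \<in> carrier_mat (count N d) (count N d)"
    and SS: "\<And>d. d > 0 \<Longrightarrow> S d * S d = 1\<^sub>m (count N d)"
    and S_adj: "\<And>d. d > 0 \<Longrightarrow> rscale ((- 1) ^ (d - 1)) (Nform d * (conj_transpose (S d) * Mform d)) = S d"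
    by metis
  \<comment> \<open>The lift repeats \<open>S d\<close> in every layer. Alternating signs make it
    anticommute with \<open>J\<close>, and counting them from the top leaves \<open>S d\<close>
    itself in the top block.\<close>
  define f :: "nat \<times> nat \<times> nat \<Rightarrow> nat \<times> nat \<times> nat \<Rightarrow> quat" where
    "f = (\<lambda>(d, i, l) (e, j, m). if d = e \<and> l = m then (- 1) ^ (d - 1 - l) * S d $$ (i, j) else 0)"
  define Y where "Y = mat n n (\<lambda>(a, b). f (jx a) (jx b))"
  have Y: "Y \<in> carrier_mat n n" and dY [simp]: "dim_row Y = n" "dim_col Y = n" by (simp_all add: Y_def)
  have Y_index: "Y $$ (ix (d, i, l), ix (e, j, m)) = (if d = e \<and> l = m then (- 1) ^ (d - 1 - l) * S d $$ (i, j) else 0)"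
    if "i < count N d" "l < d" "j < count N e" "m < e" for d i l e j m
    using that by (simp add: Y_def f_def)
  have antiY: "Y * J = - (J * Y)"
  proof (rule eq_matI)
    fix a b assume "a < dim_row (- (J * Y))" "b < dim_col (- (J * Y))"
    hence "a < n" "b < n" by auto
    then obtain d i l e j m where a: "a = ix (d, i, l)" "i < count N d" "l < d"
      and b: "b = ix (e, j, m)" "j < count N e" "m < e" by (elim ix_cases)
    have "(Y * J) $$ (a, b) = (if d = e \<and> m = Suc l then (- 1) ^ (d - 1 - l) * S d $$ (i, j) else 0)"
      using a b mult_J_index[OF Y b(2,3), of a] by (auto simp: Y_index simp del: index_mult_mat(1))
    moreover have "(J * Y) $$ (a, b) = (if d = e \<and> m = Suc l then (- 1) ^ (d - 1 - Suc l) * S d $$ (i, j) else 0)"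
      using a b J_mult_index[OF Y a(2,3), of b] by (auto simp: Y_index simp del: index_mult_mat(1))
    moreover have "(- 1) ^ (d - 1 - l) = - ((- 1 :: quat) ^ (d - 1 - Suc l))" if "Suc l < d"
    proof -
      have "d - 1 - l = Suc (d - 1 - Suc l)" using that by simp
      thus ?thesis by (simp only: power_Suc) simp
    qed
    ultimately show "(Y * J) $$ (a, b) = (- (J * Y)) $$ (a, b)"
      using \<open>a < n\<close> \<open>b < n\<close> a b by (auto simp del: index_mult_mat(1))
  qed auto
  have iY: "intertwines Y" using Y antiY by (simp add: intertwines_def)
  have topY: "top_block d Y = S d" if "d > 0" for d
    by (rule eq_matI) (use that S[OF that] in \<open>auto simp: Y_index\<close>)
  let ?Y' = "K * (conj_transpose Y * H)"
  \<comment> \<open>Averaging with the adjoint makes the map self-adjoint; by \<open>S_adj\<close>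
    both summands have top block \<open>S d\<close>, hence so does the average.\<close>
  define a where "a = rscale (1/2) (Y + ?Y')"
  have a: "a \<in> carrier_mat n n" and da [simp]: "dim_row a = n" "dim_col a = n"
    by (auto simp: a_def intro!: carrier_matI)
  have top_a: "top_block d a = S d" if "d > 0" for d
  proof -
    have "top_block d a = rscale (1/2) (top_block d Y + top_block d ?Y')"
      using that by (intro eq_matI) (auto simp: a_def simp del: index_mult_mat(1))
    also have "\<dots> = S d"
      unfolding top_adjoint[OF iY antiY that] topY[OF that] S_adj[OF that]
      using S[OF that] by (simp add: mat_rscale_add rscale_half_double)
    finally show ?thesis .
  qed
  have anti_a: "a * J = - (J * a)"
    using adjoint_anticommutes[OF Y antiY]
    by (simp add: a_def mat_rscale_mult mat_distrib_left mat_distrib_right antiY mat_uminus_add rscale_uminus[symmetric])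
  have ia: "intertwines a" using a anti_a by (simp add: intertwines_def)
  have aH: "conj_transpose a * H = H * a"
  proof -
    have "conj_transpose ?Y' * H = H * Y * (K * H)"
      by (simp add: mat_conj_transpose_mult H_hermitian K_hermitian mat_assoc)
    moreover have "H * ?Y' = H * K * (conj_transpose Y * H)" by (simp add: mat_assoc)
    moreover have "conj_transpose Y * H + H * Y = H * Y + conj_transpose Y * H"
      by (rule comm_add_mat[of _ n n]) (auto intro: carrier_matI)
    ultimately show ?thesis
      by (simp add: a_def conj_transpose_rscale mat_rscale_mult mat_conj_transpose_add mat_distrib_left
          mat_distrib_right KH HK)
  qed
  \<comment> \<open>The defect of \<open>a\<close> as an involution. It commutes with
    \<open>J\<close>, being built from \<open>a * a\<close>, and its top blocks vanish as
    \<open>S d\<close> is an involution. This yields the starting gap \<open>1\<close>.\<close>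
  define C where "C = rscale (1/2) (a * a + - 1\<^sub>m n)"
  have C: "C \<in> carrier_mat n n" and dC [simp]: "dim_row C = n" "dim_col C = n"
    by (auto simp: C_def intro!: carrier_matI)
  have "C + C = a * a + - 1\<^sub>m n" unfolding C_def by (rule rscale_half_double)
  hence aa: "a * a = 1\<^sub>m n + (C + C)"
    by simp (rule eq_matI; simp del: index_mult_mat(1))
  have aC: "a * C = C * a"
    by (simp add: C_def mat_rscale_mult mat_distrib_left mat_distrib_right mat_assoc)
  have aaJ: "a * a * J = J * (a * a)"
  proof -
    have "a * J * a = - (J * (a * a))" unfolding anti_a by (simp add: mat_assoc)
    hence "a * (J * a) = - (J * (a * a))" by (simp add: mat_assoc)
    thus ?thesis by (simp add: mat_assoc anti_a)
  qed
  have aaH: "conj_transpose a * (conj_transpose a * H) = H * (a * a)"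
  proof -
    have "conj_transpose a * H * a = H * (a * a)" unfolding aH by (simp add: mat_assoc)
    hence "conj_transpose a * (H * a) = H * (a * a)" by (simp add: mat_assoc)
    thus ?thesis by (simp add: mat_assoc aH)
  qed
  have CH: "conj_transpose C * H = H * C"
    by (simp add: C_def conj_transpose_rscale mat_rscale_mult mat_conj_transpose_add mat_conj_transpose_mult
        conj_transpose_one mat_distrib_left mat_distrib_right mat_assoc aaH)
  have CJ: "C * J = J * C"
    using aaJ by (simp add: C_def mat_rscale_mult mat_distrib_left mat_distrib_right)
  have "mat_gap weight 1 C"
  proof (rule mat_gap_commuting[OF _ CJ])
    show "intertwines C" using C CJ by (simp add: intertwines_def)
    fix d :: nat assume d: "d > 0"
    have "top_block d C = rscale (1/2) (top_block d (a * a) + - top_block d (1\<^sub>m n))"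
      using d by (intro eq_matI) (auto simp: C_def simp del: index_mult_mat(1))
    also have "\<dots> = rscale (1/2) (1\<^sub>m (count N d) + - 1\<^sub>m (count N d))"
      using d by (simp add: top_mult[OF ia ia] top_a SS top_one del: One_nat_def)
    also have "\<dots> = 0\<^sub>m (count N d) (count N d)" by (rule eq_matI) auto
    finally show "top_block d C = 0\<^sub>m (count N d) (count N d)" .
  qed
  from self_adjoint_sign[OF H J weight_less a C this _ aa aC aH anti_a CH CJ] show ?thesis by simp
qed

end

section \<open>Translation between strong reality and self-adjoint involutions\<close>

section \<open>Strongly real elements\<close>

lemma I_sig_hermitian: "conj_transpose (I_sig p q) = I_sig p q"
  by (rule eq_matI) (auto simp: I_sig_def mat_diag_def)

text \<open>An involution is its own inverse, which turns invariance of the form into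
  self-adjointness and the condition on \<open>Ad\<close> into anticommutation. Conversely,
  \<open>reduced_norm_involution\<close> gives membership in \<open>SL_quat\<close>.\<close>

lemma strongly_Ad_real_Sp_iff:
  assumes X: "X \<in> carrier_mat (p + q) (p + q)"
  shows "strongly_Ad_real (Sp_group p q) X \<longleftrightarrow> (\<exists>T \<in> carrier_mat (p + q) (p + q).
    T * T = 1\<^sub>m (p + q) \<and> conj_transpose T * I_sig p q = I_sig p q * T \<and> T * X = - (X * T))"
    (is "_ \<longleftrightarrow> ?R")
proof -
  let ?n = "p + q" and ?I = "I_sig p q"
  interpret G: group "Sp_group p q" by (rule group_Sp)
  have [simp]: "dim_row X = ?n" "dim_col X = ?n" "dim_row ?I = ?n" "dim_col ?I = ?n"
    using X I_sig_carrier[of p q] by auto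
  show ?thesis
  proof
    assume "strongly_Ad_real (Sp_group p q) X"
    then obtain T where T: "T \<in> carrier (Sp_group p q)" and TT: "T * T = 1\<^sub>m ?n"
      and Ad: "- X = Ad (Sp_group p q) T X"
      by (auto simp: strongly_Ad_real_def Sp_group_def)
    have Tc: "T \<in> carrier_mat ?n ?n" and TIT: "conj_transpose T * ?I * T = ?I"
      using T by (auto simp: Sp_group_def SL_quat_def)
    have [simp]: "dim_row T = ?n" "dim_col T = ?n" using Tc by auto
    have "inv\<^bsub>Sp_group p q\<^esub> T = T" using T TT by (intro G.inv_equality) (simp_all add: Sp_group_def)
    hence "- X = T * X * T" using Ad by (simp add: Ad_def)
    hence "- X * T = T * X * (T * T)" by (simp add: mat_assoc)
    moreover have "?I * T = conj_transpose T * ?I * (T * T)"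
      using arg_cong[OF TIT, of "\<lambda>A. A * T"] by (simp add: mat_assoc)
    ultimately show ?R using Tc TT by (intro bexI[of _ T]) (simp_all)
  next
    assume ?R
    then obtain T where Tc: "T \<in> carrier_mat ?n ?n" and TT: "T * T = 1\<^sub>m ?n"
      and TI: "conj_transpose T * ?I = ?I * T" and TX: "T * X = - (X * T)" by blast
    have [simp]: "dim_row T = ?n" "dim_col T = ?n" using Tc by auto
    have "conj_transpose T * ?I * T = ?I" unfolding TI by (simp add: mat_assoc TT)
    hence T: "T \<in> carrier (Sp_group p q)"
      using Tc reduced_norm_involution[OF Tc TT] by (simp add: Sp_group_def SL_quat_def)
    have "inv\<^bsub>Sp_group p q\<^esub> T = T" using T TT by (intro G.inv_equality) (simp_all add: Sp_group_def)
    moreover have "T * X * T = - X" unfolding TX by (simp add: mat_assoc TT)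
    ultimately show "strongly_Ad_real (Sp_group p q) X"
      using T TT unfolding strongly_Ad_real_def by (intro bexI[of _ T]) (simp_all add: Ad_def Sp_group_def)
  qed
qed

theorem theorem5p11:
  fixes p q :: nat and X :: "quat mat" and d :: "nat multiset"
  assumes "p > 0" and "q > 0"
    and "X \<in> sp_algebra p q" and "nilpotent_mat X"
    and "d \<in> partitions (p + q)" and "jordan_partition X d"
  shows "strongly_Ad_real (Sp_group p q) X \<longleftrightarrow> (\<forall>\<eta> \<in> even_parts d. even (count d \<eta>))"
proof -
  let ?n = "p + q" and ?I = "I_sig p q"
  have X: "X \<in> carrier_mat ?n ?n" and XI: "conj_transpose X * ?I + ?I * X = 0\<^sub>m ?n ?n"
    using assms(3) by (auto simp: sp_algebra_def sl_quat_def)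
  obtain ds where ds: "mset ds = d" and sim: "similar_mat X (jordan_matrix (map (\<lambda>d. (d, 0)) ds))"
    using assms(6) by (auto simp: jordan_partition_def jordan_nf_def)
  define J :: "quat mat" where "J = jordan_matrix (map (\<lambda>d. (d, 0)) ds)"
  have n: "sum_list ds = ?n" using assms(5) ds by (auto simp: partitions_def sum_mset_sum_list)
  obtain P Q where PQ: "P * Q = 1\<^sub>m ?n" "Q * P = 1\<^sub>m ?n" and XPQ: "X = P * J * Q"
    and c: "J \<in> carrier_mat ?n ?n" "P \<in> carrier_mat ?n ?n" "Q \<in> carrier_mat ?n ?n"
    using sim X unfolding J_def[symmetric] similar_mat_def similar_mat_wit_def by (auto simp: Let_def)
  note [simp] = carrier_matD[OF c(1)] carrier_matD[OF c(2)] carrier_matD[OF c(3)] carrier_matD[OF X]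
    carrier_matD[OF I_sig_carrier[of p q]]
  have cancel: "P * (Q * Z) = Z" "Q * (P * Z) = Z"
    "conj_transpose Q * (conj_transpose P * Z) = Z" "conj_transpose P * (conj_transpose Q * Z) = Z"
    if "dim_row Z = ?n" for Z
  proof -
    have "conj_transpose Q * conj_transpose P = 1\<^sub>m ?n" "conj_transpose P * conj_transpose Q = 1\<^sub>m ?n"
      using PQ by (simp_all flip: mat_conj_transpose_mult add: conj_transpose_one)
    with PQ that show "P * (Q * Z) = Z" "Q * (P * Z) = Z"
      "conj_transpose Q * (conj_transpose P * Z) = Z" "conj_transpose P * (conj_transpose Q * Z) = Z"
      by (simp_all flip: mat_assoc)
  qed
  have I2: "?I * (?I * Z) = Z" if "dim_row Z = ?n" for Z
    using that I_sig_square[of p q] by (simp flip: mat_assoc)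
  \<comment> \<open>The Gram matrix in the Jordan basis formed by the columns of \<open>P\<close>,
    and its inverse, using that \<open>I_sig\<close> squares to the identity.\<close>
  define H where "H = conj_transpose P * (?I * P)"
  define K where "K = Q * (?I * conj_transpose Q)"
  have IX: "conj_transpose X * ?I = - (?I * X)"
  proof (rule eq_matI)
    fix i j assume "i < dim_row (- (?I * X))" "j < dim_col (- (?I * X))"
    thus "(conj_transpose X * ?I) $$ (i, j) = (- (?I * X)) $$ (i, j)"
      using arg_cong[OF XI, of "\<lambda>A. A $$ (i, j)"] by (simp add: eq_neg_iff_add_eq_0 del: index_mult_mat(1))
  qed auto
  have JQP: "J = Q * (X * P)" unfolding XPQ using PQ by (simp add: mat_assoc cancel)
  obtain ix where ix: "bij_betw ix (jordan_index d) {..<?n}"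
    and J_index: "\<forall>(e, i, l) \<in> jordan_index d. \<forall>(f, j, m) \<in> jordan_index d.
      J $$ (ix (e, i, l), ix (f, j, m)) = (if e = f \<and> i = j \<and> m = Suc l then 1 else 0)"
    using jordan_matrix_index[of ds, where 'a = quat] unfolding ds n J_def by blast
  interpret hermitian_jordan d ix ?n J H K
  proof
    show "conj_transpose J * H = - (H * J)"
    proof -
      have "conj_transpose J * H = conj_transpose P * (conj_transpose X * ?I * P)"
        by (simp add: H_def JQP mat_conj_transpose_mult mat_assoc cancel)
      also have "\<dots> = - (H * J)" unfolding IX by (simp add: H_def JQP mat_assoc cancel)
      finally show ?thesis .
    qed
    show "H * K = 1\<^sub>m ?n" "K * H = 1\<^sub>m ?n"
      using PQ by (simp_all add: H_def K_def mat_assoc cancel I2 flip: mat_conj_transpose_mult)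
        (simp add: conj_transpose_one)
    show "J $$ (ix (e, i, l), ix (f, j, m)) = (if e = f \<and> i = j \<and> m = Suc l then 1 else 0)"
      if "(e, i, l) \<in> jordan_index d" "(f, j, m) \<in> jordan_index d" for e i l f j m
      using J_index that by fast
  qed (use ix c in \<open>auto simp: H_def K_def mat_conj_transpose_mult I_sig_hermitian mat_assoc
      intro: carrier_matI\<close>)
  show ?thesis
    unfolding strongly_Ad_real_Sp_iff[OF X]
  proof
    assume "\<exists>T \<in> carrier_mat ?n ?n. T * T = 1\<^sub>m ?n \<and> conj_transpose T * ?I = ?I * T \<and> T * X = - (X * T)"
    then obtain T where Tc: "T \<in> carrier_mat ?n ?n" and TT: "T * T = 1\<^sub>m ?n"
      and TI: "conj_transpose T * ?I = ?I * T" and TX: "T * X = - (X * T)" by blast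
    note [simp] = carrier_matD[OF Tc]
    \<comment> \<open>The matrix of \<open>T\<close> in the Jordan basis; the converse direction
      goes back by \<open>P * (U * Q)\<close>.\<close>
    define U where "U = Q * (T * P)"
    have U: "U \<in> carrier_mat ?n ?n" by (auto simp: U_def intro: carrier_matI)
    have "U * U = Q * (T * T * P)" by (simp add: U_def mat_assoc cancel)
    hence UU: "U * U = 1\<^sub>m ?n" by (simp add: TT PQ)
    have "U * J = Q * (T * X * P)" by (simp add: U_def JQP mat_assoc cancel)
    also have "\<dots> = - (J * U)" unfolding TX by (simp add: U_def JQP mat_assoc cancel)
    finally have UJ: "U * J = - (J * U)" .
    have "conj_transpose U * H = conj_transpose P * (conj_transpose T * ?I * P)"
      by (simp add: U_def H_def mat_conj_transpose_mult mat_assoc cancel)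
    also have "\<dots> = H * U" unfolding TI by (simp add: U_def H_def mat_assoc cancel)
    finally have UH: "conj_transpose U * H = H * U" .
    show "\<forall>\<eta> \<in> even_parts d. even (count d \<eta>)"
    proof
      fix \<eta> assume "\<eta> \<in> even_parts d"
      hence "even \<eta>" "\<eta> \<in># d" by (auto simp: even_parts_def)
      moreover from this have "\<eta> \<noteq> 0" using assms(5) by (cases "\<eta> = 0") (simp_all add: partitions_def)
      ultimately show "even (count d \<eta>)" using even_count_of_involution[OF U UU UJ UH] by simp
    qed
  next
    assume ev: "\<forall>\<eta> \<in> even_parts d. even (count d \<eta>)"
    \<comment> \<open>A size that is not a part has multiplicity \<open>0\<close>, which is
      even.\<close>
    have "even (count d \<eta>)" if "even \<eta>" for \<eta>
      using ev that by (cases "\<eta> \<in># d") (auto simp: even_parts_def not_in_iff)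
    then obtain U where U: "U \<in> carrier_mat ?n ?n" and UU: "U * U = 1\<^sub>m ?n"
      and UH: "conj_transpose U * H = H * U" and UJ: "U * J = - (J * U)"
      using self_adjoint_involution by blast
    note [simp] = carrier_matD[OF U]
    let ?T = "P * (U * Q)"
    have "?T * ?T = P * (U * U * Q)" by (simp add: mat_assoc cancel)
    hence "?T * ?T = 1\<^sub>m ?n" by (simp add: UU PQ)
    moreover have "conj_transpose ?T * ?I = ?I * ?T"
    proof -
      have "conj_transpose ?T * ?I = conj_transpose Q * (conj_transpose U * H * Q)"
        using PQ by (simp add: H_def mat_conj_transpose_mult mat_assoc)
      also have "\<dots> = ?I * ?T" unfolding UH by (simp add: H_def mat_assoc cancel)
      finally show ?thesis .
    qed
    moreover have "?T * X = - (X * ?T)"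
    proof -
      have "?T * X = P * (U * J * Q)" by (simp add: XPQ mat_assoc cancel)
      also have "\<dots> = - (X * ?T)" unfolding UJ by (simp add: XPQ mat_assoc cancel)
      finally show ?thesis .
    qed
    moreover have "?T \<in> carrier_mat ?n ?n" by (auto intro: carrier_matI)
    ultimately show "\<exists>T \<in> carrier_mat ?n ?n. T * T = 1\<^sub>m ?n \<and> conj_transpose T * ?I = ?I * T \<and> T * X = - (X * T)"
      by blast
  qed
qed

end
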